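(* Let $r\in(0,\infty)$ be fixed and $v=1/(1+1/r)$. Consider the hierarchical prior on $\mathbb{R}^n$ $$\pi(\theta)=\int_0^1\prod_{i=1}^n\left[(1-\eta)\delta_0(\theta_i)+\eta\,\tfrac{\lambda}{2}e^{-\lambda|\theta_i|}\right]\pi(\eta)\,d\eta,\qquad \eta\sim\mathrm{Beta}(a,b),$$ with $a=2$ and $b=n+1$. Choose $\lambda$ as follows: if $0<r<1$, $\lambda^2=vC_r$ for a constant $C_r>2/[v(1/2+4)]$ such that $\lambda>2$; if $r\ge1$, $\lambda^2=(1-v)C_r^*$ for a constant $C_r^*>2/[5(1-v)]$ such that $\lambda>2$. Let $\hat p$ be the corresponding Bayesian predictive density. For $\tilde M>0$ denote $c=(\tilde M^2-2)/4$. If $c>2$, then $$\sup_{\theta\in\Theta_n(s_n,\tilde M)}\rho_n(\theta,\hat p)\lesssim\frac{s_n}{r+1}\log(n/s_n)\qquad\text{and}\qquad\sup_{\theta\in\Theta_n(s_n)}\rho_n(\theta,\hat p)\lesssim\frac{s_n}{r+1}\log(n).$$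
   Context: Given $\theta\in\mathbb{R}^n$, $Y\sim N_n(\theta,I)$ is observed and the independent $\tilde Y\sim N_n(\theta,rI)$ is to be predicted, $r$ known; $\pi(Y\mid\theta)$, $\pi(\tilde Y\mid\theta)$ denote these densities. The asymptotic regime is $n\to\infty$ with $s_n/n\to0$, $1\le s_n\le n$ integers. $\Theta_n(s_n)=\{\theta\in\mathbb{R}^n:\|\theta\|_0\le s_n\}$, where $\|\theta\|_0$ is the number of nonzero coordinates, and $$\Theta_n(s_n,\tilde M)=\Theta_n(s_n)\cap\left\{\theta\in\mathbb{R}^n:\min_{i:\theta_i\ne0}|\theta_i|>\tilde M\sqrt{\log n}\right\}.$$ $\delta_0$ is the point mass at zero. For a prior $\pi$ on $\mathbb{R}^n$ the Bayesian predictive density is $\hat p(\tilde Y\mid Y)=\int\pi(\tilde Y\mid\theta)\,\pi(d\theta\mid Y)$, where $\pi(d\theta\mid Y)$ is the posterior. The risk is $$\rho_n(\theta,\hat p)=\int\pi(Y\mid\theta)\int\pi(\tilde Y\mid\theta)\log\frac{\pi(\tilde Y\mid\theta)}{\hat p(\tilde Y\mid Y)}\,d\tilde Y\,dY.$$ $A\lesssim B$ means $A\le CB$ for some universal constant $C>0$, understood as $n\to\infty$. *)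

theory Defs
  imports "HOL-Probability.Probability"
begin

text \<open>
  Points of $\mathbb{R}^n$ are extensional functions on \<open>{..<n}\<close>, i.e. elements of
  \<open>{..<n} \<rightarrow>\<^sub>E UNIV\<close>, which is the space of the product measure below.
\<close>

abbreviation lborel_n :: "nat \<Rightarrow> (nat \<Rightarrow> real) measure" where
  "lborel_n n \<equiv> \<Pi>\<^sub>M i\<in>{..<n}. lborel"

text \<open>The density of $N_n(\theta, vI)$; note that \<^const>\<open>normal_density\<close> takes the standard deviation.\<close>

definition gauss_density :: "nat \<Rightarrow> real \<Rightarrow> (nat \<Rightarrow> real) \<Rightarrow> (nat \<Rightarrow> real) \<Rightarrow> real" where
  "gauss_density n v \<theta> y = (\<Prod>i<n. normal_density (\<theta> i) (sqrt v) (y i))"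

definition beta_density :: "real \<Rightarrow> real \<Rightarrow> real \<Rightarrow> real" where
  "beta_density a b x =
     (if 0 < x \<and> x < 1 then x powr (a - 1) * (1 - x) powr (b - 1) / Beta a b else 0)"

definition laplace_density :: "real \<Rightarrow> real \<Rightarrow> real" where
  "laplace_density lam x = lam / 2 * exp (- lam * \<bar>x\<bar>)"

text \<open>
  The mixture $(1-\eta)\delta_0 + \eta\,\mathrm{Laplace}(\lambda)$, for $\eta \in [0,1]$
  (see \<open>emeasure_spike_slab\<close>).  Outside $[0,1]$, \<^const>\<open>bernoulli_pmf\<close> truncates \<open>\<eta>\<close>.
\<close>

definition spike_slab :: "real \<Rightarrow> real \<Rightarrow> real measure" where
  "spike_slab lam \<eta> = measure_pmf (bernoulli_pmf \<eta>) \<bind>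
     (\<lambda>slab. if slab then density lborel (laplace_density lam) else return borel 0)"

definition spike_slab_prior :: "nat \<Rightarrow> real \<Rightarrow> real \<Rightarrow> real \<Rightarrow> (nat \<Rightarrow> real) measure" where
  "spike_slab_prior n a b lam =
     density lborel (beta_density a b) \<bind> (\<lambda>\<eta>. \<Pi>\<^sub>M i\<in>{..<n}. spike_slab lam \<eta>)"

definition posterior ::
  "nat \<Rightarrow> (nat \<Rightarrow> real) measure \<Rightarrow> (nat \<Rightarrow> real) \<Rightarrow> (nat \<Rightarrow> real) measure" where
  "posterior n \<pi> y =
     density \<pi> (\<lambda>\<theta>. gauss_density n 1 \<theta> y / (\<integral>\<theta>'. gauss_density n 1 \<theta>' y \<partial>\<pi>))"

definition predictive_density ::
  "nat \<Rightarrow> real \<Rightarrow> (nat \<Rightarrow> real) measure \<Rightarrow> (nat \<Rightarrow> real) \<Rightarrow> (nat \<Rightarrow> real) \<Rightarrow> real" where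
  "predictive_density n r \<pi> y y' = (\<integral>\<theta>. gauss_density n r \<theta> y' \<partial>posterior n \<pi> y)"

text \<open>
  The integral of an extended-real function as the difference of the integrals of its positive
  and negative parts.  Unlike the Bochner integral, it does not collapse to 0 when the integral
  of the positive part diverges.
\<close>

definition ext_integral :: "'a measure \<Rightarrow> ('a \<Rightarrow> ereal) \<Rightarrow> ereal" where
  "ext_integral M f =
     enn2ereal (\<integral>\<^sup>+x. e2ennreal (f x) \<partial>M) - enn2ereal (\<integral>\<^sup>+x. e2ennreal (- f x) \<partial>M)"

text \<open>
  The risk $\rho_n(\theta,\hat p)$, where \<open>p y y'\<close> stands for $\hat p(y' \mid y)$.  It is meaningful
  for positive \<open>p\<close>, as are Bayesian predictive densities (see \<open>predictive_density_pos\<close>).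
\<close>

definition risk ::
  "nat \<Rightarrow> real \<Rightarrow> (nat \<Rightarrow> real) \<Rightarrow> ((nat \<Rightarrow> real) \<Rightarrow> (nat \<Rightarrow> real) \<Rightarrow> real) \<Rightarrow> ereal" where
  "risk n r \<theta> p =
     ext_integral (lborel_n n) (\<lambda>y. ereal (gauss_density n 1 \<theta> y) *
       ext_integral (lborel_n n) (\<lambda>y'.
         ereal (gauss_density n r \<theta> y' * ln (gauss_density n r \<theta> y' / p y y'))))"

definition l0_norm :: "nat \<Rightarrow> (nat \<Rightarrow> real) \<Rightarrow> nat" where
  "l0_norm n \<theta> = card {i. i < n \<and> \<theta> i \<noteq> 0}"

definition sparse_vectors :: "nat \<Rightarrow> nat \<Rightarrow> (nat \<Rightarrow> real) set" where
  "sparse_vectors n s = {\<theta> \<in> {..<n} \<rightarrow>\<^sub>E UNIV. l0_norm n \<theta> \<le> s}"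

text \<open>The minimum of $|\theta_i|$ over an empty support is $+\infty$, so the zero vector is included.\<close>

definition sparse_vectors_min :: "nat \<Rightarrow> nat \<Rightarrow> real \<Rightarrow> (nat \<Rightarrow> real) set" where
  "sparse_vectors_min n s M =
     {\<theta> \<in> sparse_vectors n s. \<forall>i<n. \<theta> i \<noteq> 0 \<longrightarrow> \<bar>\<theta> i\<bar> > M * sqrt (ln (real n))}"

definition slab_rate :: "real \<Rightarrow> real \<Rightarrow> bool" where
  "slab_rate r lam \<longleftrightarrow> (let v = 1 / (1 + 1 / r) in
     lam > 2 \<and>
     (if r < 1 then \<exists>C > 2 / (v * (1 / 2 + 4)). lam\<^sup>2 = v * C
      else \<exists>C > 2 / (5 * (1 - v)). lam\<^sup>2 = (1 - v) * C))"

subsection \<open>The prior is a probability measure and its predictive density is positive\<close>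

lemma gauss_density_measurable [measurable]:
  assumes "sets M = sets (\<Pi>\<^sub>M i\<in>{..<n}. borel)"
  shows "(\<lambda>\<theta>. gauss_density n v \<theta> y) \<in> borel_measurable M"
proof -
  have "(\<lambda>\<theta>. gauss_density n v \<theta> y) \<in> borel_measurable (\<Pi>\<^sub>M i\<in>{..<n}. borel)"
    unfolding gauss_density_def normal_density_def by measurable
  then show ?thesis using measurable_cong_sets[OF assms refl] by blast
qed

lemma gauss_density_pos: "v > 0 \<Longrightarrow> gauss_density n v \<theta> y > 0"
  unfolding gauss_density_def by (intro prod_pos ballI normal_density_pos) auto

lemma gauss_density_le: "gauss_density n v \<theta> y \<le> (1 / sqrt (2 * pi * (sqrt v)\<^sup>2)) ^ n"
proof -
  have "gauss_density n v \<theta> y \<le> (\<Prod>i<n. 1 / sqrt (2 * pi * (sqrt v)\<^sup>2))"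
    unfolding gauss_density_def
  proof (intro prod_mono conjI)
    fix i show "0 \<le> normal_density (\<theta> i) (sqrt v) (y i)" by simp
    show "normal_density (\<theta> i) (sqrt v) (y i) \<le> 1 / sqrt (2 * pi * (sqrt v)\<^sup>2)"
      unfolding normal_density_def by (intro mult_left_le) auto
  qed
  then show ?thesis by simp
qed

lemma laplace_density_measurable [measurable]: "laplace_density lam \<in> borel_measurable borel"
  unfolding laplace_density_def by measurable

lemma beta_density_measurable [measurable]: "beta_density a b \<in> borel_measurable borel"
  unfolding beta_density_def by measurable

lemma prob_space_laplace:
  assumes "lam > 0"
  shows "prob_space (density lborel (laplace_density lam))"
proof
  let ?e = "\<lambda>x. ennreal (exponential_density lam x)"
  have e: "(\<integral>\<^sup>+x. ?e x \<partial>lborel) = 1"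
    using prob_space.emeasure_space_1[OF prob_space_exponential_density[OF assms]]
    by (simp add: emeasure_density)
  have e': "(\<integral>\<^sup>+x. ?e (- x) \<partial>lborel) = 1"
    using nn_integral_real_affine[of ?e "-1" 0] e by simp
  have "AE x in lborel. x \<noteq> (0::real)"
    by (rule AE_lborel_singleton)
  then have "(\<integral>\<^sup>+x. ennreal (laplace_density lam x) \<partial>lborel)
      = (\<integral>\<^sup>+x. ennreal (1/2) * (?e x + ?e (- x)) \<partial>lborel)"
  proof (intro nn_integral_cong_AE, elim eventually_mono)
    fix x :: real assume "x \<noteq> 0"
    then have "laplace_density lam x =
        1/2 * (exponential_density lam x + exponential_density lam (- x))"
      by (auto simp: laplace_density_def exponential_density_def algebra_simps)
    then show "ennreal (laplace_density lam x) = ennreal (1/2) * (?e x + ?e (- x))"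
      using assms exponential_density_nonneg[of lam]
      by (simp only: ennreal_mult' ennreal_plus)  qed
  also have "\<dots> = ennreal (1/2) * ((\<integral>\<^sup>+x. ?e x \<partial>lborel) + (\<integral>\<^sup>+x. ?e (- x) \<partial>lborel))"
    by (subst nn_integral_cmult) (auto simp: nn_integral_add)
  also have "\<dots> = 1"
  proof -
    have "ennreal (1/2) * (1 + 1) = ennreal (1/2) * ennreal 2" by simp
    also have "\<dots> = 1" by (subst ennreal_mult[symmetric]) auto
    finally show ?thesis unfolding e e' .
  qed
  finally show "emeasure (density lborel (laplace_density lam))
      (space (density lborel (laplace_density lam))) = 1"
    by (simp add: emeasure_density)
qed

lemma prob_space_beta:
  assumes "a > 0" "b > 0"
  shows "prob_space (density lborel (beta_density a b))"
proof
  have B: "Beta a b > 0" using assms by (simp add: Beta_def Gamma_real_pos)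
  have "((\<lambda>t. t powr (a - 1) * (1 - t) powr (b - 1) / Beta a b) has_integral Beta a b / Beta a b) {0<..<1}"
    using has_integral_divide[OF has_integral_Beta_real[OF assms], of "Beta a b"]
    by (simp add: has_integral_Icc_iff_Ioo)
  then have "(beta_density a b has_integral 1) {0<..<1}"
    using B by (subst has_integral_cong[where g = "\<lambda>t. t powr (a - 1) * (1 - t) powr (b - 1) / Beta a b"])
      (auto simp: beta_density_def)
  then have I: "(beta_density a b has_integral 1) UNIV"
    by (rule has_integral_on_superset) (auto simp: beta_density_def)
  have "(\<integral>\<^sup>+x. ennreal (beta_density a b x) \<partial>lborel) = ennreal 1"
    using B by (intro nn_integral_has_integral_lborel[OF _ _ I]) (auto simp: beta_density_def)
  then show "emeasure (density lborel (beta_density a b))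
      (space (density lborel (beta_density a b))) = 1"
    by (simp add: emeasure_density)
qed

lemma
  assumes "lam > 0"
  shows sets_spike_slab: "sets (spike_slab lam \<eta>) = sets borel"
    and space_spike_slab: "space (spike_slab lam \<eta>) = UNIV"
    and prob_space_spike_slab: "prob_space (spike_slab lam \<eta>)"
    and emeasure_spike_slab': "A \<in> sets borel \<Longrightarrow> emeasure (spike_slab lam \<eta>) A =
      (\<integral>\<^sup>+z. emeasure (if z then density lborel (laplace_density lam) else return borel 0) A
         \<partial>bernoulli_pmf \<eta>)"
proof -
  let ?K = "\<lambda>z. if z then density lborel (laplace_density lam) else return borel 0"
  have K: "?K \<in> measure_pmf (bernoulli_pmf \<eta>) \<rightarrow>\<^sub>M prob_algebra borel"
    by (auto simp: space_prob_algebra prob_space_laplace[OF assms] prob_space_return)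
  show S: "sets (spike_slab lam \<eta>) = sets borel"
    unfolding spike_slab_def by (rule sets_bind) (auto simp: space_prob_algebra)
  then show "space (spike_slab lam \<eta>) = UNIV"
    using sets_eq_imp_space_eq by fastforce
  show "prob_space (spike_slab lam \<eta>)"
    unfolding spike_slab_def
    using K by (intro prob_space_bind'[where M = "measure_pmf (bernoulli_pmf \<eta>)" and N = borel])
      (auto simp: space_prob_algebra prob_space_measure_pmf)
  show "emeasure (spike_slab lam \<eta>) A = (\<integral>\<^sup>+z. emeasure (?K z) A \<partial>bernoulli_pmf \<eta>)"
    if "A \<in> sets borel"
    unfolding spike_slab_def using that K
    by (intro emeasure_bind[where N = borel] measurable_prob_algebraD) auto
qed

lemma emeasure_spike_slab:
  assumes "lam > 0" "0 \<le> \<eta>" "\<eta> \<le> 1" "A \<in> sets borel"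
  shows "emeasure (spike_slab lam \<eta>) A =
    ennreal (1 - \<eta>) * indicator A 0 + ennreal \<eta> * (\<integral>\<^sup>+x\<in>A. laplace_density lam x \<partial>lborel)"
  using assms by (simp add: emeasure_spike_slab' emeasure_density mult.commute add.commute)

lemma measurable_spike_slab:
  fixes n :: nat
  assumes "lam > 0"
  shows "(\<lambda>\<eta>. \<Pi>\<^sub>M i\<in>{..<n}. spike_slab lam \<eta>) \<in> borel \<rightarrow>\<^sub>M prob_algebra (\<Pi>\<^sub>M i\<in>{..<n}. borel)"
proof (rule measurable_prob_algebra_generated)
  show "sets (\<Pi>\<^sub>M i\<in>{..<n}. borel) = sigma_sets (\<Pi>\<^sub>E i\<in>{..<n}. space borel)
     (prod_algebra {..<n} (\<lambda>_. borel :: real measure))"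
    by (rule sets_PiM)
  show "Int_stable (prod_algebra {..<n} (\<lambda>_. borel :: real measure))"
    by (rule Int_stable_prod_algebra)
  show "prod_algebra {..<n} (\<lambda>_. borel :: real measure) \<subseteq> Pow (\<Pi>\<^sub>E i\<in>{..<n}. space borel)"
    by (rule prod_algebra_sets_into_space)
  fix \<eta> :: real
  show "prob_space (\<Pi>\<^sub>M i\<in>{..<n}. spike_slab lam \<eta>)"
    by (intro prob_space_PiM prob_space_spike_slab assms)
  show "sets (\<Pi>\<^sub>M i\<in>{..<n}. spike_slab lam \<eta>) = sets (\<Pi>\<^sub>M i\<in>{..<n}. borel)"
    by (intro sets_PiM_cong sets_spike_slab assms refl)
next
  fix A assume "A \<in> prod_algebra {..<n} (\<lambda>_. borel :: real measure)"
  then obtain E where A: "A = Pi\<^sub>E {..<n} E" and E: "\<And>i. i < n \<Longrightarrow> E i \<in> sets borel"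
    by (auto simp: prod_algebra_eq_finite Pi_iff)
  have "emeasure (\<Pi>\<^sub>M i\<in>{..<n}. spike_slab lam \<eta>) A = (\<Prod>i<n. emeasure (spike_slab lam \<eta>) (E i))" for \<eta>
  proof -
    interpret product_prob_space "\<lambda>_. spike_slab lam \<eta>" "{..<n}"
      by (simp add: product_prob_space_def product_prob_space_axioms_def product_sigma_finite_def
          prob_space_spike_slab[OF assms] prob_space_imp_sigma_finite)
    show ?thesis
      unfolding A by (rule emeasure_PiM) (simp_all add: sets_spike_slab[OF assms] E)
  qed
  moreover have "(\<lambda>\<eta>. \<Prod>i<n. emeasure (spike_slab lam \<eta>) (E i)) \<in> borel_measurable borel"
  proof (intro borel_measurable_prod_ennreal)
    fix i assume i: "i \<in> {..<n}"
    have "emeasure (spike_slab lam \<eta>) (E i) =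
        ennreal (1 - max 0 (min 1 \<eta>)) * indicator (E i) 0 +
        ennreal (max 0 (min 1 \<eta>)) * (\<integral>\<^sup>+x\<in>E i. laplace_density lam x \<partial>lborel)" for \<eta>
    proof -
      have "bernoulli_pmf \<eta> = bernoulli_pmf (max 0 (min 1 \<eta>))"
        by (intro pmf_eqI, unfold bernoulli_pmf.rep_eq) simp
      then have "spike_slab lam \<eta> = spike_slab lam (max 0 (min 1 \<eta>))"
        by (simp add: spike_slab_def)
      then show ?thesis
        using emeasure_spike_slab[OF assms, of "max 0 (min 1 \<eta>)" "E i"] E i by simp
    qed
    then show "(\<lambda>\<eta>. emeasure (spike_slab lam \<eta>) (E i)) \<in> borel_measurable borel"
      by simp
  qed
  ultimately show "(\<lambda>\<eta>. emeasure (\<Pi>\<^sub>M i\<in>{..<n}. spike_slab lam \<eta>) A) \<in> borel_measurable borel"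
    by simp
qed

lemma
  assumes "a > 0" "b > 0" "lam > 0"
  shows sets_spike_slab_prior: "sets (spike_slab_prior n a b lam) = sets (\<Pi>\<^sub>M i\<in>{..<n}. borel)"
    and prob_space_spike_slab_prior: "prob_space (spike_slab_prior n a b lam)"
    and emeasure_spike_slab_prior: "A \<in> sets (\<Pi>\<^sub>M i\<in>{..<n}. borel) \<Longrightarrow>
      emeasure (spike_slab_prior n a b lam) A =
        (\<integral>\<^sup>+\<eta>. beta_density a b \<eta> * emeasure (\<Pi>\<^sub>M i\<in>{..<n}. spike_slab lam \<eta>) A \<partial>lborel)"
proof -
  let ?B = "density lborel (beta_density a b)"
  have K: "(\<lambda>\<eta>. \<Pi>\<^sub>M i\<in>{..<n}. spike_slab lam \<eta>) \<in> ?B \<rightarrow>\<^sub>M prob_algebra (\<Pi>\<^sub>M i\<in>{..<n}. borel)"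
    using measurable_spike_slab[OF assms(3)] by simp
  have B: "?B \<in> space (prob_algebra borel)"
    using prob_space_beta[OF assms(1,2)] by (simp add: space_prob_algebra)
  show "sets (spike_slab_prior n a b lam) = sets (\<Pi>\<^sub>M i\<in>{..<n}. borel)"
    unfolding spike_slab_prior_def
    by (rule sets_bind) (simp_all add: sets_spike_slab assms cong: sets_PiM_cong)
  show "prob_space (spike_slab_prior n a b lam)"
    unfolding spike_slab_prior_def
    using prob_space_bind'[OF B] K by simp
  show "emeasure (spike_slab_prior n a b lam) A =
      (\<integral>\<^sup>+\<eta>. beta_density a b \<eta> * emeasure (\<Pi>\<^sub>M i\<in>{..<n}. spike_slab lam \<eta>) A \<partial>lborel)"
    if A: "A \<in> sets (\<Pi>\<^sub>M i\<in>{..<n}. borel)"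
  proof -
    have "(\<lambda>\<eta>. emeasure (\<Pi>\<^sub>M i\<in>{..<n}. spike_slab lam \<eta>) A) \<in> borel_measurable borel"
      using measurable_emeasure_kernel[OF measurable_prob_algebraD[OF measurable_spike_slab[OF assms(3)]] A] .
    then show ?thesis
      unfolding spike_slab_prior_def
      by (subst emeasure_bind[OF _ measurable_prob_algebraD[OF K] A]) (auto simp: nn_integral_density)
  qed
qed

lemma predictive_density_pos:
  assumes "prob_space \<pi>" "sets \<pi> = sets (\<Pi>\<^sub>M i\<in>{..<n}. borel)" "r > 0"
  shows "predictive_density n r \<pi> y y' > 0"
proof -
  interpret prob_space \<pi> by fact
  note M [measurable] = gauss_density_measurable[OF assms(2)]
  have int: "integrable \<pi> (\<lambda>\<theta>. gauss_density n v \<theta> z)" if "v > 0" for v z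
  proof (rule integrable_const_bound[OF _ M])
    show "AE \<theta> in \<pi>. norm (gauss_density n v \<theta> z) \<le> (1 / sqrt (2 * pi * (sqrt v)\<^sup>2)) ^ n"
      using gauss_density_le gauss_density_pos[OF that] by (intro AE_I2) (metis abs_of_pos real_norm_def)
  qed
  let ?m = "\<integral>\<theta>. gauss_density n 1 \<theta> y \<partial>\<pi>"
  have m: "?m > 0"
    by (rule expectation_greater) (auto intro!: int AE_I2 gauss_density_pos)
  have "predictive_density n r \<pi> y y' =
      (\<integral>\<theta>. gauss_density n 1 \<theta> y / ?m * gauss_density n r \<theta> y' \<partial>\<pi>)"
    unfolding predictive_density_def posterior_def using m
    by (subst integral_real_density) (auto intro!: divide_nonneg_nonneg less_imp_le[OF gauss_density_pos])
  also have "\<dots> > 0"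
  proof (rule expectation_greater)
    show "integrable \<pi> (\<lambda>\<theta>. gauss_density n 1 \<theta> y / ?m * gauss_density n r \<theta> y')"
    proof (rule Bochner_Integration.integrable_bound)
      show "integrable \<pi> (\<lambda>\<theta>. (1 / sqrt (2 * pi * (sqrt 1)\<^sup>2)) ^ n / ?m * gauss_density n r \<theta> y')"
        using int[OF assms(3)] by simp
      have "norm (gauss_density n 1 \<theta> y / ?m * gauss_density n r \<theta> y')
          \<le> norm ((1 / sqrt (2 * pi * (sqrt 1)\<^sup>2)) ^ n / ?m * gauss_density n r \<theta> y')" for \<theta>
        using m assms(3) gauss_density_le[of n 1 \<theta> y] gauss_density_pos[of 1 n \<theta> y]
          gauss_density_pos[of r n \<theta> y']
        unfolding real_norm_def abs_mult abs_divide
        by (intro mult_right_mono divide_right_mono) auto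
      then show "AE \<theta> in \<pi>. norm (gauss_density n 1 \<theta> y / ?m * gauss_density n r \<theta> y')
          \<le> norm ((1 / sqrt (2 * pi * (sqrt 1)\<^sup>2)) ^ n / ?m * gauss_density n r \<theta> y')"
        by (rule AE_I2)
    qed measurable
  qed (use m assms(3) gauss_density_pos in auto)
  finally show ?thesis .
qed

end

theory Submission
  imports Defs
begin

text \<open>
  Write \<open>z = y + y' / r\<close> and \<open>\<tau> = 1 + 1 / r\<close> for the natural statistic and the precision of the
  data and the future data combined.  With \<open>N\<^sub>1(y)\<close> and \<open>N\<^sub>\<tau>(z)\<close> the ratios of the prior
  predictive densities to the pure noise densities, the logarithmic loss of the predictive density
  is exactly
  \<open>\<Sum>i (\<theta>\<^sub>i y'\<^sub>i / r - \<theta>\<^sub>i\<^sup>2 / (2 r)) + ln N\<^sub>1(y) - ln N\<^sub>\<tau>(z)\<close>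
  (\<open>predictive_density_eq\<close>).  Both ratios are integrals over the same prior of \<open>\<eta>\<close> of products of
  one-dimensional mixtures \<open>1 - \<eta> + \<eta> g\<close>, where \<open>g\<close> is the likelihood ratio of a Laplace slab.
  The risk is small because the difference of the logarithms nearly cancels, and the proof
  arranges this cancellation inside the integrals, so that the posterior
  distribution of \<open>\<eta>\<close> never has to be located.

  The noise coordinates are removed from \<open>N\<^sub>1\<close> by \<open>ln N \<le> ln J + N / J - 1\<close>, where \<open>J\<close> is the
  mixture over the support \<open>S\<close> of \<open>\<theta>\<close> only: the quotient \<open>N / J\<close> has mean one
  (\<open>nn_integral_mix_ratio_quotient\<close>).  In \<open>N\<^sub>\<tau>\<close> they contribute at least \<open>(1 - \<eta>)\<^sup>n\<close>, which the prior
  \<open>Beta(2, n + 1)\<close> absorbs at a bounded cost per signal (\<open>mix_ratio_compare\<close>).  The same step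
  makes \<open>\<eta>\<close> at least of order \<open>1 / n\<close>.

  What remains is a comparison of the mixtures \<open>1 - \<eta> + \<eta> g\<close> at the precisions \<open>1\<close> and \<open>\<tau>\<close>, one
  signal coordinate at a time.  The logarithm of the slab ratio is determined up to
  bounded errors and squared noise, and in the comparison all terms that depend on the signal
  cancel pointwise (\<open>slab_ratio_log_bound\<close>).  Therefore a signal above \<open>sqrt (8 ln n)\<close>, for which
  the slab dominates at both precisions, costs \<open>O(1)\<close>.  A smaller one costs \<open>O(ln n / r) + O(1)\<close> if
  \<open>r \<ge> 1\<close>, because its log-likelihoods at the two precisions differ by that much only, and
  \<open>ln n + O(1)\<close> in any case (\<open>coord_ratio_compare\<close>).  Here \<open>O(1)\<close> depends on \<open>r\<close> and
  \<open>lam\<close>, but it is dominated by \<open>ln (n / s\<^sub>n) / (r + 1)\<close>, which tends to infinity; this is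
  how the final constant is universal.  Under the signal strength condition of the first bound all
  signals are large, as \<open>M\<^sup>2 > 10\<close>.
\<close>

section \<open>The likelihood ratio of one slab coordinate\<close>

text \<open>
  \<open>gauss_tilt \<tau> z t\<close> is the likelihood ratio of the mean \<open>t\<close> against the mean \<open>0\<close> for a
  Gaussian observation of precision \<open>\<tau>\<close>, in terms of the natural statistic \<open>z\<close>, the observation
  times \<open>\<tau>\<close>.  In this parametrization independent observations combine by addition in both
  \<open>\<tau>\<close> and \<open>z\<close>, so that the pair (data, future data) is again a single observation.
\<close>

definition gauss_tilt :: "real \<Rightarrow> real \<Rightarrow> real \<Rightarrow> real" where
  "gauss_tilt \<tau> z t = exp (z * t - \<tau> * t\<^sup>2 / 2)"

definition slab_ratio :: "real \<Rightarrow> real \<Rightarrow> real \<Rightarrow> real" where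
  "slab_ratio lam \<tau> z = (\<integral>t. laplace_density lam t * gauss_tilt \<tau> z t \<partial>lborel)"

lemma gauss_tilt_pos [simp]: "0 < gauss_tilt \<tau> z t" "0 \<le> gauss_tilt \<tau> z t"
  by (auto simp: gauss_tilt_def)

lemma gauss_tilt_zero [simp]: "gauss_tilt \<tau> z 0 = 1"
  by (simp add: gauss_tilt_def)

lemma gauss_tilt_mult:
  "gauss_tilt \<tau> z t * gauss_tilt \<tau>' z' t = gauss_tilt (\<tau> + \<tau>') (z + z') t"
  by (simp add: gauss_tilt_def exp_add [symmetric] algebra_simps add_divide_distrib)

lemma gauss_tilt_measurable [measurable]:
  assumes [measurable]: "f \<in> borel_measurable M" "g \<in> borel_measurable M"
  shows "(\<lambda>x. gauss_tilt \<tau> (f x) (g x)) \<in> borel_measurable M"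
  unfolding gauss_tilt_def by measurable

lemma gauss_tilt_le:
  assumes "\<tau> > 0"
  shows "gauss_tilt \<tau> z t \<le> exp (z\<^sup>2 / (2 * \<tau>))"
proof -
  have "z * t - \<tau> * t\<^sup>2 / 2 = z\<^sup>2 / (2 * \<tau>) - \<tau> / 2 * (t - z / \<tau>)\<^sup>2"
    using assms by (simp add: power2_eq_square field_simps)
  also have "\<dots> \<le> z\<^sup>2 / (2 * \<tau>)"
    using assms by simp
  finally show ?thesis
    by (simp add: gauss_tilt_def)
qed

lemma laplace_density_nonneg: "lam > 0 \<Longrightarrow> 0 \<le> laplace_density lam t"
  by (simp add: laplace_density_def)

lemma nn_integral_laplace:
  assumes "lam > 0"
  shows "(\<integral>\<^sup>+t. ennreal (laplace_density lam t) \<partial>lborel) = 1"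
  using prob_space.emeasure_space_1[OF prob_space_laplace[OF assms]] by (simp add: emeasure_density)

lemma integrable_laplace_tilt:
  assumes "lam > 0" "\<tau> > 0"
  shows "integrable lborel (\<lambda>t. laplace_density lam t * gauss_tilt \<tau> z t)"
proof (rule Bochner_Integration.integrable_bound)
  have "integrable lborel (laplace_density lam)"
    using nn_integral_laplace[OF assms(1)] laplace_density_nonneg[OF assms(1)]
    by (intro integrableI_nonneg) auto
  then show "integrable lborel (\<lambda>t. laplace_density lam t * exp (z\<^sup>2 / (2 * \<tau>)))"
    by simp
  show "(\<lambda>t. laplace_density lam t * gauss_tilt \<tau> z t) \<in> borel_measurable lborel"
    by measurable
  show "AE t in lborel. norm (laplace_density lam t * gauss_tilt \<tau> z t)
      \<le> norm (laplace_density lam t * exp (z\<^sup>2 / (2 * \<tau>)))"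
    using assms by (intro AE_I2)
      (auto simp: abs_mult laplace_density_nonneg intro!: mult_left_mono gauss_tilt_le)
qed

lemma nn_integral_laplace_tilt:
  assumes "lam > 0" "\<tau> > 0"
  shows "(\<integral>\<^sup>+t. ennreal (laplace_density lam t) * ennreal (gauss_tilt \<tau> z t) \<partial>lborel)
    = ennreal (slab_ratio lam \<tau> z)"
  unfolding slab_ratio_def
  using nn_integral_eq_integral[OF integrable_laplace_tilt[OF assms, of z]]
    laplace_density_nonneg[OF assms(1)]
  by (simp add: ennreal_mult)

lemma slab_ratio_measurable [measurable]:
  assumes [measurable]: "f \<in> borel_measurable M"
  shows "(\<lambda>x. slab_ratio lam \<tau> (f x)) \<in> borel_measurable M"
proof -
  have "(\<lambda>z. slab_ratio lam \<tau> z) \<in> borel_measurable borel"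
    unfolding slab_ratio_def by measurable
  then show ?thesis
    using assms by (rule measurable_compose_rev)
qed

lemma nn_integral_normal_density:
  assumes "\<sigma> > 0"
  shows "(\<integral>\<^sup>+x. ennreal (normal_density \<mu> \<sigma> x) \<partial>lborel) = 1"
  using prob_space.emeasure_space_1[OF prob_space_normal_density[OF assms]]
  by (simp add: emeasure_density)

text \<open>
  After \<open>y t \<le> \<bar>y\<bar> \<bar>t\<bar>\<close> the integrand is a function of \<open>\<bar>t\<bar>\<close>, and completing the square in \<open>\<bar>t\<bar>\<close>
  keeps the factor \<open>exp (- lam \<bar>y\<bar>)\<close>.  Bounding \<open>exp (- lam \<bar>t\<bar>)\<close> by the two exponentials
  \<open>exp (\<plusminus> lam t)\<close> instead would give \<open>exp (lam \<bar>y\<bar>)\<close>.  The factor has to be the same as in the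
  lower bound, so that the two cancel for signals of any size.
\<close>

lemma slab_ratio_upper:
  assumes "lam > 0"
  shows "slab_ratio lam 1 y \<le> lam * sqrt (2 * pi) * exp ((\<bar>y\<bar> - lam)\<^sup>2 / 2)"
proof -
  define m where "m = \<bar>y\<bar> - lam"
  let ?c = "lam / 2 * sqrt (2 * pi) * exp (m\<^sup>2 / 2)"
  have pw: "laplace_density lam t * gauss_tilt 1 y t
      \<le> ?c * (normal_density m 1 t + normal_density (- m) 1 t)" for t
  proof -
    have "y * t \<le> \<bar>y\<bar> * \<bar>t\<bar>"
      by (metis abs_ge_self abs_mult)
    then have "y * t - t\<^sup>2 / 2 - lam * \<bar>t\<bar> \<le> m * \<bar>t\<bar> - \<bar>t\<bar>\<^sup>2 / 2"
      by (simp add: m_def algebra_simps)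
    also have "\<dots> = m\<^sup>2 / 2 - (\<bar>t\<bar> - m)\<^sup>2 / 2"
      by (simp add: power2_eq_square field_simps)
    finally have "laplace_density lam t * gauss_tilt 1 y t
        \<le> lam / 2 * exp (m\<^sup>2 / 2) * exp (- (\<bar>t\<bar> - m)\<^sup>2 / 2)"
      using assms by (simp add: laplace_density_def gauss_tilt_def exp_add [symmetric])
    also have "\<dots> \<le> lam / 2 * exp (m\<^sup>2 / 2) * (exp (- (t - m)\<^sup>2 / 2) + exp (- (t + m)\<^sup>2 / 2))"
    proof (rule mult_left_mono)
      have "(- t - m)\<^sup>2 = (t + m)\<^sup>2"
        by (simp add: power2_eq_square algebra_simps)
      then show "exp (- (\<bar>t\<bar> - m)\<^sup>2 / 2) \<le> exp (- (t - m)\<^sup>2 / 2) + exp (- (t + m)\<^sup>2 / 2)"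
        by (cases "t \<ge> 0") auto
    qed (use assms in simp)
    also have "\<dots> = ?c * (normal_density m 1 t + normal_density (- m) 1 t)"
      by (simp add: normal_density_def algebra_simps)
    finally show ?thesis .
  qed
  have "slab_ratio lam 1 y
      \<le> (\<integral>t. ?c * (normal_density m 1 t + normal_density (- m) 1 t) \<partial>lborel)"
    unfolding slab_ratio_def using assms pw
    by (intro integral_mono integrable_laplace_tilt) auto
  also have "\<dots> = ?c * 2"
    by simp
  finally show ?thesis
    by (simp add: m_def mult.commute)
qed

definition slab_const :: "real \<Rightarrow> real \<Rightarrow> real" where
  "slab_const lam \<tau> = lam / 2 * exp (- lam\<^sup>2 / 2) * sqrt (2 * pi / (\<tau> + 1))"

lemma slab_const_pos: "lam > 0 \<Longrightarrow> \<tau> > 0 \<Longrightarrow> slab_const lam \<tau> > 0"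
  by (simp add: slab_const_def)

text \<open>
  Around the centre \<open>z / \<tau>\<close> of the tilt the Laplace density drops by a bounded factor only:
  \<open>lam \<bar>h\<bar> \<le> lam\<^sup>2 / 2 + h\<^sup>2 / 2\<close> leaves a Gaussian integral in the distance \<open>h\<close> from the centre.
\<close>

lemma slab_ratio_lower:
  assumes "lam > 0" "\<tau> > 0"
  shows "slab_const lam \<tau> * exp (z\<^sup>2 / (2 * \<tau>) - lam * \<bar>z\<bar> / \<tau>) \<le> slab_ratio lam \<tau> z"
proof -
  define w where "w = z / \<tau>"
  define \<sigma> where "\<sigma> = sqrt (1 / (\<tau> + 1))"
  have \<sigma>: "\<sigma> > 0" "\<sigma>\<^sup>2 = 1 / (\<tau> + 1)"
    using assms by (auto simp: \<sigma>_def)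
  let ?E = "exp (z\<^sup>2 / (2 * \<tau>) - lam * \<bar>z\<bar> / \<tau>)"
  have pw: "slab_const lam \<tau> * ?E * normal_density w \<sigma> t \<le> laplace_density lam t * gauss_tilt \<tau> z t"
    for t
  proof -
    define h where "h = t - w"
    have t: "t = h + w" by (simp add: h_def)
    have "0 \<le> (\<bar>h\<bar> - lam)\<^sup>2 / 2" by simp
    then have h: "lam * \<bar>h\<bar> \<le> lam\<^sup>2 / 2 + h\<^sup>2 / 2"
      by (simp add: power2_eq_square algebra_simps)
    have "lam * \<bar>t\<bar> \<le> lam * \<bar>h\<bar> + lam * \<bar>w\<bar>"
      using assms by (simp add: t distrib_left [symmetric])
    moreover have "z * t - \<tau> * t\<^sup>2 / 2 = z\<^sup>2 / (2 * \<tau>) - \<tau> / 2 * h\<^sup>2"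
      using assms by (simp add: h_def w_def power2_eq_square field_simps)
    moreover have "\<bar>w\<bar> = \<bar>z\<bar> / \<tau>"
      using assms by (simp add: w_def)
    ultimately have *: "z\<^sup>2 / (2 * \<tau>) - lam * \<bar>z\<bar> / \<tau> - lam\<^sup>2 / 2 - (\<tau> + 1) / 2 * h\<^sup>2
        \<le> - lam * \<bar>t\<bar> + (z * t - \<tau> * t\<^sup>2 / 2)"
      using h distrib_right[of \<tau> 1 "h\<^sup>2"] by (simp add: add_divide_distrib algebra_simps)
    have "slab_const lam \<tau> * normal_density w \<sigma> t
        = lam / 2 * exp (- lam\<^sup>2 / 2) * exp (- ((\<tau> + 1) / 2 * h\<^sup>2))"
    proof -
      have "(t - w)\<^sup>2 / (2 * \<sigma>\<^sup>2) = (\<tau> + 1) / 2 * h\<^sup>2" "2 * pi * \<sigma>\<^sup>2 = 2 * pi / (\<tau> + 1)"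
        using assms by (simp_all add: \<sigma>(2) h_def)
      moreover have "\<tau> + 1 \<noteq> 0"
        using assms by simp
      ultimately show ?thesis
        unfolding slab_const_def normal_density_def by simp
    qed
    then have "slab_const lam \<tau> * ?E * normal_density w \<sigma> t
        = ?E * (lam / 2 * exp (- lam\<^sup>2 / 2) * exp (- ((\<tau> + 1) / 2 * h\<^sup>2)))"
      by (simp only: mult.commute [of "slab_const lam \<tau>" ?E] mult.assoc)
    also have "\<dots> = lam / 2 * exp ((z\<^sup>2 / (2 * \<tau>) - lam * \<bar>z\<bar> / \<tau>) + - lam\<^sup>2 / 2
        + - ((\<tau> + 1) / 2 * h\<^sup>2))"
      unfolding exp_add by (simp only: mult_ac)
    also have "\<dots> \<le> lam / 2 * exp (- lam * \<bar>t\<bar> + (z * t - \<tau> * t\<^sup>2 / 2))"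
      using * assms by simp
    also have "\<dots> = laplace_density lam t * gauss_tilt \<tau> z t"
      by (simp add: laplace_density_def gauss_tilt_def exp_add [symmetric])
    finally show ?thesis .
  qed
  have "slab_const lam \<tau> * ?E = (\<integral>t. slab_const lam \<tau> * ?E * normal_density w \<sigma> t \<partial>lborel)"
    using \<sigma> by simp
  also have "\<dots> \<le> slab_ratio lam \<tau> z"
    unfolding slab_ratio_def using assms \<sigma> pw
    by (intro integral_mono integrable_laplace_tilt) auto
  finally show ?thesis .
qed

lemma slab_ratio_pos:
  assumes "lam > 0" "\<tau> > 0"
  shows "slab_ratio lam \<tau> z > 0"
  by (rule less_le_trans[OF _ slab_ratio_lower[OF assms]]) (simp add: slab_const_pos assms)

lemma slab_ratio_one_lower:
  assumes "lam > 0"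
  shows "ln (slab_const lam 1) + y\<^sup>2 / 2 - lam * \<bar>y\<bar> \<le> ln (slab_ratio lam 1 y)"
proof -
  have "ln (slab_const lam 1 * exp (y\<^sup>2 / 2 - lam * \<bar>y\<bar>)) \<le> ln (slab_ratio lam 1 y)"
    using slab_ratio_lower[OF assms, of 1 y] slab_const_pos[OF assms, of 1]
      slab_ratio_pos[OF assms, of 1 y]
    by (subst ln_le_cancel_iff) auto
  then show ?thesis
    using slab_const_pos[OF assms, of 1] by (simp add: ln_mult)
qed

text \<open>Tonelli: the slab marginal of a noise observation is a probability density.\<close>

lemma nn_integral_noise_slab_ratio:
  assumes "lam > 0"
  shows "(\<integral>\<^sup>+y. ennreal (normal_density 0 1 y) * ennreal (slab_ratio lam 1 y) \<partial>lborel) = 1"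
proof -
  have "(\<integral>\<^sup>+y. ennreal (normal_density 0 1 y) * ennreal (slab_ratio lam 1 y) \<partial>lborel)
      = (\<integral>\<^sup>+y. \<integral>\<^sup>+t. ennreal (normal_density 0 1 y) *
          (ennreal (laplace_density lam t) * ennreal (gauss_tilt 1 y t)) \<partial>lborel \<partial>lborel)"
    using assms by (subst nn_integral_cmult) (auto simp: nn_integral_laplace_tilt)
  also have "\<dots> = (\<integral>\<^sup>+t. \<integral>\<^sup>+y. ennreal (normal_density 0 1 y) *
          (ennreal (laplace_density lam t) * ennreal (gauss_tilt 1 y t)) \<partial>lborel \<partial>lborel)"
    by (rule lborel_pair.Fubini') measurable
  also have "\<dots> = (\<integral>\<^sup>+t. ennreal (laplace_density lam t) *
      (\<integral>\<^sup>+y. ennreal (normal_density t 1 y) \<partial>lborel) \<partial>lborel)"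
  proof (rule nn_integral_cong, subst nn_integral_cmult [symmetric], goal_cases)
    case (2 t)
    have "normal_density 0 1 y * gauss_tilt 1 y t = normal_density t 1 y" for y
      by (simp add: normal_density_def gauss_tilt_def exp_add [symmetric] power2_eq_square
          field_simps)
    then show ?case
      using assms by (intro nn_integral_cong)
        (metis (no_types, lifting) ennreal_mult gauss_tilt_pos(2) mult.left_commute
          normal_density_nonneg)
  qed simp
  also have "\<dots> = 1"
    using assms by (simp add: nn_integral_normal_density nn_integral_laplace)
  finally show ?thesis .
qed

section \<open>The likelihood ratio of the prior predictive distribution\<close>

definition coord_ratio :: "real \<Rightarrow> real \<Rightarrow> real \<Rightarrow> real \<Rightarrow> real" where
  "coord_ratio lam \<tau> \<eta> z = 1 - \<eta> + \<eta> * slab_ratio lam \<tau> z"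

text \<open>
  For \<open>A = {..<n}\<close> this is the ratio of the marginal density of the observation under the
  hierarchical prior to the pure noise density.  Smaller \<open>A\<close> arise by integrating out noise
  coordinates, while the prior on \<open>\<eta>\<close> keeps its dependence on \<open>n\<close>.
\<close>

definition mix_ratio :: "nat \<Rightarrow> real \<Rightarrow> real \<Rightarrow> nat set \<Rightarrow> (nat \<Rightarrow> real) \<Rightarrow> ennreal" where
  "mix_ratio n lam \<tau> A z =
     (\<integral>\<^sup>+\<eta>. ennreal (beta_density 2 (real n + 1) \<eta>) *
        (\<Prod>i\<in>A. ennreal (coord_ratio lam \<tau> \<eta> (z i))) \<partial>lborel)"

lemma coord_ratio_nonneg:
  "lam > 0 \<Longrightarrow> \<tau> > 0 \<Longrightarrow> 0 \<le> \<eta> \<Longrightarrow> \<eta> \<le> 1 \<Longrightarrow> 0 \<le> coord_ratio lam \<tau> \<eta> z"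
  using slab_ratio_pos[of lam \<tau> z] by (simp add: coord_ratio_def)

lemma coord_ratio_pos:
  "lam > 0 \<Longrightarrow> \<tau> > 0 \<Longrightarrow> 0 \<le> \<eta> \<Longrightarrow> \<eta> < 1 \<Longrightarrow> 0 < coord_ratio lam \<tau> \<eta> z"
  using slab_ratio_pos[of lam \<tau> z] by (simp add: coord_ratio_def add_pos_nonneg)

lemma coord_ratio_measurable [measurable]:
  assumes [measurable]: "f \<in> borel_measurable M" "g \<in> borel_measurable M"
  shows "(\<lambda>x. coord_ratio lam \<tau> (f x) (g x)) \<in> borel_measurable M"
  unfolding coord_ratio_def by measurable

lemma beta_density_nonneg: "a > 0 \<Longrightarrow> b > 0 \<Longrightarrow> 0 \<le> beta_density a b \<eta>"
  by (simp add: beta_density_def Beta_def Gamma_real_pos less_imp_le)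

lemma nn_integral_beta_density:
  "a > 0 \<Longrightarrow> b > 0 \<Longrightarrow> (\<integral>\<^sup>+\<eta>. ennreal (beta_density a b \<eta>) \<partial>lborel) = 1"
  using prob_space.emeasure_space_1[OF prob_space_beta[of a b]] by (simp add: emeasure_density)

lemma beta_density_eq_0: "\<not> (0 < \<eta> \<and> \<eta> < 1) \<Longrightarrow> beta_density a b \<eta> = 0"
  by (auto simp: beta_density_def)

lemma beta_density_2_nat:
  "0 < \<eta> \<Longrightarrow> \<eta> < 1 \<Longrightarrow> beta_density 2 (real n + 1) \<eta> = \<eta> * (1 - \<eta>) ^ n / Beta 2 (real n + 1)"
  by (simp add: beta_density_def powr_realpow)

lemma nn_integral_spike_slab:
  assumes "lam > 0" "0 \<le> \<eta>" "\<eta> \<le> 1" and [measurable]: "f \<in> borel_measurable borel"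
  shows "(\<integral>\<^sup>+t. f t \<partial>spike_slab lam \<eta>) =
    ennreal \<eta> * (\<integral>\<^sup>+t. ennreal (laplace_density lam t) * f t \<partial>lborel) + ennreal (1 - \<eta>) * f 0"
proof -
  let ?K = "\<lambda>z. if z then density lborel (laplace_density lam) else return borel (0::real)"
  have K: "?K \<in> measure_pmf (bernoulli_pmf \<eta>) \<rightarrow>\<^sub>M subprob_algebra borel"
    by (intro measurable_prob_algebraD)
      (auto simp: space_prob_algebra prob_space_laplace[OF assms(1)] prob_space_return)
  show ?thesis
    unfolding spike_slab_def using assms
    by (subst nn_integral_bind[OF _ K])
      (auto simp: nn_integral_density nn_integral_return mult.commute)
qed

lemma nn_integral_prior_tilt:
  assumes "lam > 0" "\<tau> > 0"
  shows "(\<integral>\<^sup>+\<theta>. (\<Prod>i<n. ennreal (gauss_tilt \<tau> (z i) (\<theta> i)))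
      \<partial>spike_slab_prior n 2 (real n + 1) lam) = mix_ratio n lam \<tau> {..<n} z"
proof -
  let ?f = "\<lambda>\<theta>. \<Prod>i<n. ennreal (gauss_tilt \<tau> (z i) (\<theta> i))"
  let ?B = "density lborel (beta_density 2 (real n + 1))"
  have K: "(\<lambda>\<eta>. \<Pi>\<^sub>M i\<in>{..<n}. spike_slab lam \<eta>) \<in> borel \<rightarrow>\<^sub>M subprob_algebra (\<Pi>\<^sub>M i\<in>{..<n}. borel)"
    by (rule measurable_prob_algebraD[OF measurable_spike_slab[OF assms(1)]])
  then have K': "(\<lambda>\<eta>. \<Pi>\<^sub>M i\<in>{..<n}. spike_slab lam \<eta>) \<in> ?B \<rightarrow>\<^sub>M subprob_algebra (\<Pi>\<^sub>M i\<in>{..<n}. borel)"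
    by simp
  have f [measurable]: "?f \<in> borel_measurable (\<Pi>\<^sub>M i\<in>{..<n}. borel)"
    by measurable
  have M [measurable]: "(\<lambda>\<eta>. \<integral>\<^sup>+\<theta>. ?f \<theta> \<partial>(\<Pi>\<^sub>M i\<in>{..<n}. spike_slab lam \<eta>)) \<in> borel_measurable borel"
    using measurable_compose[OF K nn_integral_measurable_subprob_algebra[OF f]] .
  have *: "(\<integral>\<^sup>+\<theta>. ?f \<theta> \<partial>(\<Pi>\<^sub>M i\<in>{..<n}. spike_slab lam \<eta>))
      = (\<Prod>i<n. ennreal (coord_ratio lam \<tau> \<eta> (z i)))" if \<eta>: "0 < \<eta>" "\<eta> < 1" for \<eta>
  proof -
    interpret product_prob_space "\<lambda>_. spike_slab lam \<eta>" "{..<n}"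
      by (simp add: product_prob_space_def product_prob_space_axioms_def product_sigma_finite_def
          prob_space_spike_slab[OF assms(1)] prob_space_imp_sigma_finite)
    have [measurable_cong]: "sets (spike_slab lam \<eta>) = sets borel"
      by (rule sets_spike_slab[OF assms(1)])
    have "(\<integral>\<^sup>+t. ennreal (gauss_tilt \<tau> x t) \<partial>spike_slab lam \<eta>) = ennreal (coord_ratio lam \<tau> \<eta> x)"
      for x
      using \<eta> assms slab_ratio_pos[OF assms, of x]
      by (simp add: nn_integral_spike_slab nn_integral_laplace_tilt coord_ratio_def
          ennreal_mult ennreal_plus add.commute)
    then show ?thesis
      by (subst product_nn_integral_prod) auto
  qed
  have "(\<integral>\<^sup>+\<theta>. ?f \<theta> \<partial>spike_slab_prior n 2 (real n + 1) lam)
      = (\<integral>\<^sup>+\<eta>. ennreal (beta_density 2 (real n + 1) \<eta>) *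
          (\<integral>\<^sup>+\<theta>. ?f \<theta> \<partial>(\<Pi>\<^sub>M i\<in>{..<n}. spike_slab lam \<eta>)) \<partial>lborel)"
    unfolding spike_slab_prior_def
    by (subst nn_integral_bind[OF f K']) (simp add: nn_integral_density)
  also have "\<dots> = mix_ratio n lam \<tau> {..<n} z"
    unfolding mix_ratio_def
  proof (rule nn_integral_cong)
    fix \<eta> :: real
    show "ennreal (beta_density 2 (real n + 1) \<eta>) *
          (\<integral>\<^sup>+\<theta>. ?f \<theta> \<partial>(\<Pi>\<^sub>M i\<in>{..<n}. spike_slab lam \<eta>)) =
        ennreal (beta_density 2 (real n + 1) \<eta>) * (\<Prod>i<n. ennreal (coord_ratio lam \<tau> \<eta> (z i)))"
      by (cases "0 < \<eta> \<and> \<eta> < 1") (simp_all add: * beta_density_eq_0)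
  qed
  finally show ?thesis .
qed

lemma mix_ratio_finite:
  assumes "lam > 0" "\<tau> > 0" "finite A"
  shows "mix_ratio n lam \<tau> A z < \<infinity>"
proof -
  let ?c = "\<Prod>i\<in>A. ennreal (1 + slab_ratio lam \<tau> (z i))"
  have "mix_ratio n lam \<tau> A z
      \<le> (\<integral>\<^sup>+\<eta>. ennreal (beta_density 2 (real n + 1) \<eta>) * ?c \<partial>lborel)"
    unfolding mix_ratio_def
  proof (rule nn_integral_mono)
    fix \<eta> :: real
    show "ennreal (beta_density 2 (real n + 1) \<eta>) *
        (\<Prod>i\<in>A. ennreal (coord_ratio lam \<tau> \<eta> (z i))) \<le> ennreal (beta_density 2 (real n + 1) \<eta>) * ?c"
    proof (cases "0 < \<eta> \<and> \<eta> < 1")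
      case True
      have "coord_ratio lam \<tau> \<eta> x \<le> 1 + slab_ratio lam \<tau> x" for x
        using True slab_ratio_pos[OF assms(1,2), of x]
        by (simp add: coord_ratio_def mult_left_le_one_le add_mono)
      then show ?thesis
        by (intro mult_left_mono prod_mono_ennreal) (auto simp: ennreal_leI)
    qed (simp add: beta_density_eq_0)
  qed
  also have "\<dots> = ?c"
    by (subst nn_integral_multc) (auto simp: nn_integral_beta_density)
  also have "\<dots> < \<infinity>"
    by (simp add: ennreal_prod_eq_top less_top [symmetric])
  finally show ?thesis .
qed

lemma mix_ratio_pos:
  assumes "lam > 0" "\<tau> > 0" "finite A"
  shows "mix_ratio n lam \<tau> A z > 0"
proof (rule ccontr)
  assume "\<not> mix_ratio n lam \<tau> A z > 0"
  then have "AE \<eta> in lborel. ennreal (beta_density 2 (real n + 1) \<eta>) *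
      (\<Prod>i\<in>A. ennreal (coord_ratio lam \<tau> \<eta> (z i))) = 0"
    unfolding mix_ratio_def by (subst (asm) not_gr_zero, subst (asm) nn_integral_0_iff_AE) auto
  then have "AE \<eta> in lborel. ennreal (beta_density 2 (real n + 1) \<eta>) = 0"
  proof (rule eventually_mono)
    fix \<eta> assume *: "ennreal (beta_density 2 (real n + 1) \<eta>) *
      (\<Prod>i\<in>A. ennreal (coord_ratio lam \<tau> \<eta> (z i))) = 0"
    show "ennreal (beta_density 2 (real n + 1) \<eta>) = 0"
    proof (cases "0 < \<eta> \<and> \<eta> < 1")
      case True
      then have "(\<Prod>i\<in>A. ennreal (coord_ratio lam \<tau> \<eta> (z i))) \<noteq> 0"
        using assms coord_ratio_pos[OF assms(1,2)]
        by (auto simp: ennreal_eq_0_iff not_le [symmetric])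
      then show ?thesis
        using * by (metis mult_eq_0_iff)
    qed (simp add: beta_density_eq_0)
  qed
  then have "(\<integral>\<^sup>+\<eta>. ennreal (beta_density 2 (real n + 1) \<eta>) \<partial>lborel) = 0"
    by (subst nn_integral_0_iff_AE) auto
  then show False
    by (simp add: nn_integral_beta_density)
qed

lemma mix_ratio_measurable [measurable]:
  assumes "\<And>i. i \<in> A \<Longrightarrow> (\<lambda>x. z x i) \<in> borel_measurable M" "finite A"
  shows "(\<lambda>x. mix_ratio n lam \<tau> A (z x)) \<in> borel_measurable M"
proof -
  have "(\<lambda>(x, \<eta>). ennreal (coord_ratio lam \<tau> \<eta> (z x i)))
      \<in> borel_measurable (M \<Otimes>\<^sub>M lborel)" if "i \<in> A" for i
  proof -
    have [measurable]: "(\<lambda>x. z x i) \<in> borel_measurable M"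
      using assms that by auto
    show ?thesis by measurable
  qed
  then have [measurable]: "(\<lambda>p. \<Prod>i\<in>A. ennreal (coord_ratio lam \<tau> (snd p) (z (fst p) i)))
      \<in> borel_measurable (M \<Otimes>\<^sub>M lborel)"
    by (intro borel_measurable_prod_ennreal) (auto simp: case_prod_beta')
  show ?thesis
    unfolding mix_ratio_def
    by (intro lborel.borel_measurable_nn_integral) (simp add: case_prod_beta', measurable)
qed


section \<open>The risk in terms of likelihood ratios\<close>

lemma gauss_density_eq_tilt:
  assumes "v > 0"
  shows "gauss_density n v \<theta> y
    = gauss_density n v (\<lambda>_. 0) y * (\<Prod>i<n. gauss_tilt (1 / v) (y i / v) (\<theta> i))"
proof -
  have "normal_density t (sqrt v) x = normal_density 0 (sqrt v) x * gauss_tilt (1 / v) (x / v) t"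
    for t x
    using assms
    by (simp add: normal_density_def gauss_tilt_def exp_add [symmetric] power2_eq_square field_simps)
  then show ?thesis
    unfolding gauss_density_def prod.distrib [symmetric] by (intro prod.cong refl)
qed

lemma integral_prior_tilt:
  assumes "lam > 0" "\<tau> > 0"
  shows "(\<integral>\<theta>. (\<Prod>i<n. gauss_tilt \<tau> (z i) (\<theta> i)) \<partial>spike_slab_prior n 2 (real n + 1) lam)
    = enn2real (mix_ratio n lam \<tau> {..<n} z)"
proof -
  have [measurable_cong]:
    "sets (spike_slab_prior n 2 (real n + 1) lam) = sets (\<Pi>\<^sub>M i\<in>{..<n}. borel)"
    by (rule sets_spike_slab_prior) (use assms in auto)
  show ?thesis
    using assms
    by (subst integral_eq_nn_integral)
      (auto intro!: prod_nonneg simp: nn_integral_prior_tilt prod_ennreal [symmetric])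
qed

lemma predictive_density_eq:
  assumes "lam > 0" "r > 0"
  shows "predictive_density n r (spike_slab_prior n 2 (real n + 1) lam) y y' =
    gauss_density n r (\<lambda>_. 0) y' *
    enn2real (mix_ratio n lam (1 + 1 / r) {..<n} (\<lambda>i. y i + y' i / r)) /
    enn2real (mix_ratio n lam 1 {..<n} y)"
proof -
  let ?P = "spike_slab_prior n 2 (real n + 1) lam"
  have s: "sets ?P = sets (\<Pi>\<^sub>M i\<in>{..<n}. borel)"
    by (rule sets_spike_slab_prior) (use assms in auto)
  note M [measurable] = gauss_density_measurable[OF s]
  let ?m = "\<integral>\<theta>. gauss_density n 1 \<theta> y \<partial>?P"
  let ?g1 = "gauss_density n 1 (\<lambda>_. 0) y" and ?gr = "gauss_density n r (\<lambda>_. 0) y'"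
  have m: "?m = ?g1 * enn2real (mix_ratio n lam 1 {..<n} y)"
    unfolding Bochner_Integration.integral_cong[OF refl gauss_density_eq_tilt[OF zero_less_one]]
    using integral_prior_tilt[OF assms(1) zero_less_one] by simp
  have m0: "?m \<ge> 0"
    unfolding m by (intro mult_nonneg_nonneg less_imp_le[OF gauss_density_pos]) auto
  have g1: "?g1 \<noteq> 0"
    using gauss_density_pos[of 1 n "\<lambda>_. 0" y] by simp
  have "predictive_density n r ?P y y' = (\<integral>\<theta>. gauss_density n 1 \<theta> y / ?m * gauss_density n r \<theta> y' \<partial>?P)"
    unfolding predictive_density_def posterior_def using m0
    by (subst integral_real_density) (auto intro!: divide_nonneg_nonneg less_imp_le[OF gauss_density_pos])
  also have "\<dots> = (\<integral>\<theta>. ?g1 * ?gr / ?m *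
      (\<Prod>i<n. gauss_tilt (1 + 1 / r) (y i + y' i / r) (\<theta> i)) \<partial>?P)"
  proof (rule Bochner_Integration.integral_cong)
    fix \<theta>
    show "gauss_density n 1 \<theta> y / ?m * gauss_density n r \<theta> y' =
        ?g1 * ?gr / ?m * (\<Prod>i<n. gauss_tilt (1 + 1 / r) (y i + y' i / r) (\<theta> i))"
      unfolding gauss_density_eq_tilt[OF zero_less_one, of n \<theta> y]
        gauss_density_eq_tilt[OF assms(2), of n \<theta> y']
      by (simp add: gauss_tilt_mult [symmetric] prod.distrib)
  qed simp
  also have "\<dots> = ?g1 * ?gr / ?m * enn2real (mix_ratio n lam (1 + 1 / r) {..<n} (\<lambda>i. y i + y' i / r))"
    using assms by (simp add: integral_prior_tilt add_pos_pos)
  finally show ?thesis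
    using g1 by (simp add: m)
qed

section \<open>Comparing precisions under the same prior\<close>

text \<open>
  Passing from \<open>\<eta>\<close> to \<open>(\<eta> + 1/n) / 4\<close> costs a constant factor per coordinate and a constant
  overall: the coordinate ratios shrink at most by the factor 8, and \<open>Beta(2, n + 1)\<close> has just
  the exponent for which the spike factors of the coordinates outside \<open>A\<close>, at least \<open>(1 - \<eta>)\<^sup>n\<close> together,
  can be absorbed into the prior density.  In exchange the coordinates need to be compared only
  for \<open>\<eta> \<ge> 1/(4n)\<close>, where the slab of a large signal dominates.  The adaptation to the unknown
  sparsity happens in the integral over \<open>\<eta>\<close>, which stands on both sides.
\<close>

lemma mix_ratio_compare:
  assumes "lam > 0" "\<tau> > 0" "A \<subseteq> {..<n}" "n \<ge> 1"
    and R: "\<And>i \<eta>. i \<in> A \<Longrightarrow> 1 / (4 * real n) \<le> \<eta> \<Longrightarrow> \<eta> \<le> 1 / 2 \<Longrightarrow>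
      coord_ratio lam 1 \<eta> (y i) \<le> exp (R i) * coord_ratio lam \<tau> \<eta> (z i)"
  shows "mix_ratio n lam 1 A y
    \<le> ennreal (64 * 8 ^ card A * exp (\<Sum>i\<in>A. R i)) * mix_ratio n lam \<tau> {..<n} z"
proof -
  have fin: "finite A"
    using assms(3) finite_subset by blast
  define b where "b = beta_density 2 (real n + 1)"
  define s where "s \<eta> = 1 / (4 * real n) + 1 / 4 * \<eta>" for \<eta>
  define F where "F \<eta> = ennreal (b \<eta>) * (\<Prod>i<n. ennreal (coord_ratio lam \<tau> \<eta> (z i)))" for \<eta>
  let ?c = "8 ^ card A * exp (\<Sum>i\<in>A. R i)"
  have [measurable]: "F \<in> borel_measurable borel"
    unfolding F_def b_def by measurable
  have pw: "ennreal (b \<eta>) * (\<Prod>i\<in>A. ennreal (coord_ratio lam 1 \<eta> (y i))) \<le> ennreal (16 * ?c) * F (s \<eta>)"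
    for \<eta>
  proof (cases "0 < \<eta> \<and> \<eta> < 1")
    case False
    then show ?thesis
      by (simp add: b_def beta_density_eq_0)
  next
    case \<eta>: True
    have n: "1 / (4 * real n) \<le> 1 / 4" "0 < 1 / (4 * real n)"
      using assms(4) by (auto simp: field_simps)
    have s: "1 / (4 * real n) \<le> s \<eta>" "s \<eta> \<le> 1 / 2" "0 < s \<eta>" "s \<eta> < 1" "\<eta> / 4 \<le> s \<eta>"
      using \<eta> n unfolding s_def by linarith+
    have B: "Beta 2 (real n + 1) > 0"
      by (simp add: Beta_def Gamma_real_pos)
    \<comment> \<open>the exponents \<open>n\<close> of the prior and \<open>n - card A \<le> n\<close> of the spikes outside \<open>A\<close> add up\<close>
    have pow: "(1 - \<eta>) ^ n \<le> 4 * (1 - s \<eta>) ^ (2 * n)"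
    proof -
      have le: "(1 - \<eta> / 2) * (1 - 1 / (2 * real n)) \<le> 1 - s \<eta>"
      proof -
        define d where "d = 1 / (4 * real n)"
        have d: "0 < d" "s \<eta> = d + \<eta> / 4" "1 / (2 * real n) = 2 * d"
          using n by (simp_all add: d_def s_def)
        have "\<eta> * d \<le> 1 * d"
          using \<eta> d by (intro mult_right_mono) auto
        then show ?thesis
          unfolding d(2,3) using \<eta> by (simp add: algebra_simps)
      qed
      have "1 / 2 \<le> (1 - 1 / (2 * real n)) ^ n"
        using Bernoulli_inequality[of "- 1 / (2 * real n)" n] assms(4) by (simp add: field_simps)
      then have "(1 / 2)\<^sup>2 \<le> ((1 - 1 / (2 * real n)) ^ n)\<^sup>2"
        by (intro power_mono) auto
      then have q: "1 / 4 \<le> (1 - 1 / (2 * real n)) ^ (2 * n)"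
        by (simp add: power2_eq_square power_even_eq)
      have "(1 - \<eta>) ^ n \<le> ((1 - \<eta> / 2)\<^sup>2) ^ n"
        using \<eta> by (intro power_mono) (auto simp: power2_eq_square algebra_simps)
      also have "\<dots> = (1 - \<eta> / 2) ^ (2 * n) * 1"
        by (simp add: power_mult)
      also have "\<dots> \<le> (1 - \<eta> / 2) ^ (2 * n) * (4 * (1 - 1 / (2 * real n)) ^ (2 * n))"
        using q \<eta> by (intro mult_left_mono) auto
      also have "\<dots> = 4 * ((1 - \<eta> / 2) * (1 - 1 / (2 * real n))) ^ (2 * n)"
        by (simp add: power_mult_distrib)
      also have "\<dots> \<le> 4 * (1 - s \<eta>) ^ (2 * n)"
        using le \<eta> assms(4)
        by (intro mult_left_mono power_mono mult_nonneg_nonneg) (auto simp: field_simps)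
      finally show ?thesis .
    qed
    have P1: "(\<Prod>i\<in>A. coord_ratio lam 1 \<eta> (y i)) \<le> ?c * (\<Prod>i\<in>A. coord_ratio lam \<tau> (s \<eta>) (z i))"
    proof -
      have "(\<Prod>i\<in>A. coord_ratio lam 1 \<eta> (y i))
          \<le> (\<Prod>i\<in>A. 8 * (exp (R i) * coord_ratio lam \<tau> (s \<eta>) (z i)))"
      proof (intro prod_mono conjI)
        fix i assume i: "i \<in> A"
        show "0 \<le> coord_ratio lam 1 \<eta> (y i)"
          using \<eta> assms by (intro coord_ratio_nonneg) auto
        have g: "0 < slab_ratio lam 1 (y i)"
          using assms by (intro slab_ratio_pos) auto
        have "\<eta> * slab_ratio lam 1 (y i) \<le> 4 * s \<eta> * slab_ratio lam 1 (y i)"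
          using s g by (intro mult_right_mono) auto
        moreover have "0 \<le> s \<eta> * slab_ratio lam 1 (y i)"
          using s g by simp
        ultimately have "coord_ratio lam 1 \<eta> (y i) \<le> 8 * coord_ratio lam 1 (s \<eta>) (y i)"
          using s conjunct1[OF \<eta>] by (simp add: coord_ratio_def algebra_simps)
        then show "coord_ratio lam 1 \<eta> (y i) \<le> 8 * (exp (R i) * coord_ratio lam \<tau> (s \<eta>) (z i))"
          using R[OF i s(1,2)] by linarith
      qed
      also have "\<dots> = ?c * (\<Prod>i\<in>A. coord_ratio lam \<tau> (s \<eta>) (z i))"
        using fin by (simp add: prod.distrib exp_sum)
      finally show ?thesis .
    qed
    have P2: "(1 - s \<eta>) ^ n \<le> (\<Prod>i\<in>{..<n} - A. coord_ratio lam \<tau> (s \<eta>) (z i))"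
    proof -
      have "(1 - s \<eta>) ^ n \<le> (1 - s \<eta>) ^ card ({..<n} - A)"
        using s card_mono[of "{..<n}" "{..<n} - A"] by (intro power_decreasing) auto
      also have "\<dots> = (\<Prod>i\<in>{..<n} - A. 1 - s \<eta>)"
        by simp
      also have "\<dots> \<le> (\<Prod>i\<in>{..<n} - A. coord_ratio lam \<tau> (s \<eta>) (z i))"
      proof (intro prod_mono conjI)
        fix i
        show "1 - s \<eta> \<le> coord_ratio lam \<tau> (s \<eta>) (z i)"
          using slab_ratio_pos[OF assms(1,2), of "z i"] s by (simp add: coord_ratio_def)
      qed (use s in auto)
      finally show ?thesis .
    qed
    let ?PA = "\<Prod>i\<in>A. coord_ratio lam \<tau> (s \<eta>) (z i)"
    have PA: "0 \<le> ?PA"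
      using s assms by (intro prod_nonneg coord_ratio_nonneg) auto
    have PI: "(\<Prod>i<n. coord_ratio lam \<tau> (s \<eta>) (z i))
        = (\<Prod>i\<in>{..<n} - A. coord_ratio lam \<tau> (s \<eta>) (z i)) * ?PA"
      using assms(3) by (intro prod.subset_diff) auto
    have "b \<eta> * (\<Prod>i\<in>A. coord_ratio lam 1 \<eta> (y i))
        \<le> (4 * s \<eta> * (4 * (1 - s \<eta>) ^ (2 * n)) / Beta 2 (real n + 1)) * (?c * ?PA)"
    proof (intro mult_mono P1)
      show "b \<eta> \<le> 4 * s \<eta> * (4 * (1 - s \<eta>) ^ (2 * n)) / Beta 2 (real n + 1)"
      proof -
        have "\<eta> * (1 - \<eta>) ^ n \<le> (4 * s \<eta>) * (4 * (1 - s \<eta>) ^ (2 * n))"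
          using \<eta> s pow by (intro mult_mono) auto
        then show ?thesis
          unfolding b_def using \<eta> B
          by (subst beta_density_2_nat) (auto intro: divide_right_mono)
      qed
      show "0 \<le> (\<Prod>i\<in>A. coord_ratio lam 1 \<eta> (y i))"
        using \<eta> assms by (intro prod_nonneg coord_ratio_nonneg) auto
      show "0 \<le> 4 * s \<eta> * (4 * (1 - s \<eta>) ^ (2 * n)) / Beta 2 (real n + 1)"
        using s B by (intro divide_nonneg_pos mult_nonneg_nonneg) auto
    qed
    also have "\<dots> = 16 * ?c * (b (s \<eta>) * ((1 - s \<eta>) ^ n * ?PA))"
      unfolding b_def using s by (subst beta_density_2_nat) (auto simp: power_add mult_2)
    also have "\<dots> \<le> 16 * ?c * (b (s \<eta>) * (\<Prod>i<n. coord_ratio lam \<tau> (s \<eta>) (z i)))"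
      unfolding PI using P2 PA
      by (intro mult_left_mono mult_right_mono) (auto simp: b_def beta_density_nonneg)
    finally have "b \<eta> * (\<Prod>i\<in>A. coord_ratio lam 1 \<eta> (y i))
        \<le> 16 * ?c * (b (s \<eta>) * (\<Prod>i<n. coord_ratio lam \<tau> (s \<eta>) (z i)))" .
    then have "ennreal (b \<eta> * (\<Prod>i\<in>A. coord_ratio lam 1 \<eta> (y i)))
        \<le> ennreal (16 * ?c * (b (s \<eta>) * (\<Prod>i<n. coord_ratio lam \<tau> (s \<eta>) (z i))))"
      by (rule ennreal_leI)
    moreover have "(\<Prod>i\<in>A. ennreal (coord_ratio lam 1 \<eta> (y i))) = ennreal (\<Prod>i\<in>A. coord_ratio lam 1 \<eta> (y i))"
      using \<eta> assms by (intro prod_ennreal coord_ratio_nonneg) auto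
    moreover have "(\<Prod>i<n. ennreal (coord_ratio lam \<tau> (s \<eta>) (z i)))
        = ennreal (\<Prod>i<n. coord_ratio lam \<tau> (s \<eta>) (z i))"
      using s assms by (intro prod_ennreal coord_ratio_nonneg) auto
    moreover have "0 \<le> b x" for x
      by (simp add: b_def beta_density_nonneg)
    ultimately show ?thesis
      unfolding F_def by (simp add: ennreal_mult')
  qed
  have "mix_ratio n lam 1 A y \<le> (\<integral>\<^sup>+\<eta>. ennreal (16 * ?c) * F (s \<eta>) \<partial>lborel)"
    unfolding mix_ratio_def b_def [symmetric] by (intro nn_integral_mono pw)
  also have "\<dots> = ennreal (16 * ?c) * (\<integral>\<^sup>+\<eta>. F (s \<eta>) \<partial>lborel)"
    by (intro nn_integral_cmult) (simp add: s_def, measurable)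
  also have "\<dots> = ennreal (64 * ?c) * (ennreal (1 / 4) * (\<integral>\<^sup>+\<eta>. F (s \<eta>) \<partial>lborel))"
    by (subst mult.assoc [symmetric], subst ennreal_mult [symmetric]) (auto simp: mult_ac)
  also have "ennreal (1 / 4) * (\<integral>\<^sup>+\<eta>. F (s \<eta>) \<partial>lborel) = (\<integral>\<^sup>+\<eta>. F \<eta> \<partial>lborel)"
    using nn_integral_real_affine[of F "1 / 4" "1 / (4 * real n)"] by (simp add: s_def)
  also have "\<dots> = mix_ratio n lam \<tau> {..<n} z"
    by (simp add: F_def b_def mix_ratio_def)
  finally show ?thesis
    by (simp add: mult.assoc)
qed

section \<open>Integrating out the noise coordinates\<close>

lemma nn_integral_noise_coord_ratio:
  assumes "lam > 0" "0 < \<eta>" "\<eta> < 1"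
  shows "(\<integral>\<^sup>+y. ennreal (normal_density 0 1 y) * ennreal (coord_ratio lam 1 \<eta> y) \<partial>lborel) = 1"
proof -
  have g: "0 < slab_ratio lam 1 y" for y
    using assms by (intro slab_ratio_pos) auto
  have "(\<integral>\<^sup>+y. ennreal (normal_density 0 1 y) * ennreal (coord_ratio lam 1 \<eta> y) \<partial>lborel)
      = (\<integral>\<^sup>+y. ennreal (1 - \<eta>) * ennreal (normal_density 0 1 y) +
          ennreal \<eta> * (ennreal (normal_density 0 1 y) * ennreal (slab_ratio lam 1 y)) \<partial>lborel)"
  proof (rule nn_integral_cong)
    fix y :: real
    let ?p = "normal_density 0 1 y"
    have "ennreal ?p * ennreal (coord_ratio lam 1 \<eta> y)
        = ennreal ((1 - \<eta>) * ?p + \<eta> * (?p * slab_ratio lam 1 y))"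
      by (subst ennreal_mult' [symmetric]) (simp_all add: coord_ratio_def algebra_simps)
    also have "\<dots> = ennreal ((1 - \<eta>) * ?p) + ennreal (\<eta> * (?p * slab_ratio lam 1 y))"
      using assms g[of y] by (intro ennreal_plus mult_nonneg_nonneg) auto
    finally show "ennreal ?p * ennreal (coord_ratio lam 1 \<eta> y) = ennreal (1 - \<eta>) * ennreal ?p
        + ennreal \<eta> * (ennreal ?p * ennreal (slab_ratio lam 1 y))"
      using assms by (simp add: ennreal_mult')
  qed
  also have "\<dots> = ennreal (1 - \<eta>) + ennreal \<eta>"
    using assms by (simp add: nn_integral_add nn_integral_cmult nn_integral_normal_density
        nn_integral_noise_slab_ratio)
  also have "\<dots> = 1"
    using assms by (simp add: ennreal_plus [symmetric] del: ennreal_plus)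
  finally show ?thesis .
qed

lemma nn_integral_mix_ratio_noise:
  assumes "lam > 0" and fin: "finite S" "finite T" "S \<inter> T = {}"
  shows "(\<integral>\<^sup>+w. (\<Prod>i\<in>T. ennreal (normal_density 0 1 (w i))) *
      mix_ratio n lam 1 (S \<union> T) (merge S T (x, w)) \<partial>(\<Pi>\<^sub>M i\<in>T. lborel)) = mix_ratio n lam 1 S x"
proof -
  interpret L: product_sigma_finite "\<lambda>_. lborel :: real measure" by standard
  interpret LT: finite_product_sigma_finite "\<lambda>_. lborel :: real measure" T
    by standard (rule fin)
  interpret P: pair_sigma_finite "\<Pi>\<^sub>M i\<in>T. (lborel :: real measure)" "lborel :: real measure" ..
  let ?b = "\<lambda>\<eta>. ennreal (beta_density 2 (real n + 1) \<eta>)"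
  let ?p = "\<lambda>w. \<Prod>i\<in>T. ennreal (normal_density 0 1 (w i))"
  let ?cS = "\<lambda>\<eta>. \<Prod>i\<in>S. ennreal (coord_ratio lam 1 \<eta> (x i))"
  let ?cT = "\<lambda>\<eta> w. \<Prod>i\<in>T. ennreal (coord_ratio lam 1 \<eta> (w i))"
  have m: "mix_ratio n lam 1 (S \<union> T) (merge S T (x, w)) = (\<integral>\<^sup>+\<eta>. ?b \<eta> * (?cS \<eta> * ?cT \<eta> w) \<partial>lborel)"
    for w
  proof -
    have "(\<Prod>i\<in>S \<union> T. ennreal (coord_ratio lam 1 \<eta> (merge S T (x, w) i))) = ?cS \<eta> * ?cT \<eta> w" for \<eta>
      using fin by (subst prod.union_disjoint) (auto intro!: arg_cong2[where f = times] prod.cong simp: merge_def)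
    then show ?thesis
      by (simp add: mix_ratio_def)
  qed
  have "(\<integral>\<^sup>+w. ?p w * mix_ratio n lam 1 (S \<union> T) (merge S T (x, w)) \<partial>(\<Pi>\<^sub>M i\<in>T. lborel))
      = (\<integral>\<^sup>+w. \<integral>\<^sup>+\<eta>. ?p w * (?b \<eta> * (?cS \<eta> * ?cT \<eta> w)) \<partial>lborel \<partial>(\<Pi>\<^sub>M i\<in>T. lborel))"
    unfolding m by (intro nn_integral_cong nn_integral_cmult [symmetric]) measurable
  also have "\<dots> = (\<integral>\<^sup>+\<eta>. \<integral>\<^sup>+w. ?p w * (?b \<eta> * (?cS \<eta> * ?cT \<eta> w)) \<partial>(\<Pi>\<^sub>M i\<in>T. lborel) \<partial>lborel)"
    by (rule P.Fubini' [symmetric]) measurable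
  also have "\<dots> = mix_ratio n lam 1 S x"
    unfolding mix_ratio_def
  proof (rule nn_integral_cong)
    fix \<eta> :: real
    have "(\<integral>\<^sup>+w. ?p w * (?b \<eta> * (?cS \<eta> * ?cT \<eta> w)) \<partial>(\<Pi>\<^sub>M i\<in>T. lborel))
        = (\<integral>\<^sup>+w. (?b \<eta> * ?cS \<eta>) * (\<Prod>i\<in>T. ennreal (normal_density 0 1 (w i)) *
            ennreal (coord_ratio lam 1 \<eta> (w i))) \<partial>(\<Pi>\<^sub>M i\<in>T. lborel))"
      by (intro nn_integral_cong) (simp add: prod.distrib ac_simps)
    also have "\<dots> = (?b \<eta> * ?cS \<eta>) * (\<Prod>i\<in>T. \<integral>\<^sup>+y. ennreal (normal_density 0 1 y) *
            ennreal (coord_ratio lam 1 \<eta> y) \<partial>lborel)"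
      using fin by (subst nn_integral_cmult, measurable)
        (subst L.product_nn_integral_prod, auto)
    also have "\<dots> = ?b \<eta> * ?cS \<eta>"
      using assms(1) nn_integral_noise_coord_ratio
      by (cases "0 < \<eta> \<and> \<eta> < 1") (simp_all add: beta_density_eq_0)
    finally show "(\<integral>\<^sup>+w. ?p w * (?b \<eta> * (?cS \<eta> * ?cT \<eta> w)) \<partial>(\<Pi>\<^sub>M i\<in>T. lborel)) = ?b \<eta> * ?cS \<eta>" .
  qed
  finally show ?thesis .
qed

text \<open>
  Conditionally on the signal coordinates, the density ratio of all coordinates has mean equal to
  that of the signal coordinates alone; this replaces Jensen's inequality for the logarithm.
\<close>

lemma nn_integral_mix_ratio_quotient:
  assumes "lam > 0" "S \<subseteq> {..<n}" and noise: "\<And>i. i < n \<Longrightarrow> i \<notin> S \<Longrightarrow> \<theta> i = 0"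
  shows "(\<integral>\<^sup>+y. ennreal (gauss_density n 1 \<theta> y) *
    (mix_ratio n lam 1 {..<n} y / mix_ratio n lam 1 S y) \<partial>lborel_n n) = 1"
proof -
  interpret L: product_sigma_finite "\<lambda>_. lborel :: real measure" by standard
  define T where "T = {..<n} - S"
  have ST: "S \<union> T = {..<n}" "S \<inter> T = {}" "finite S" "finite T"
    using assms(2) finite_subset by (auto simp: T_def)
  let ?q = "\<lambda>x. \<Prod>i\<in>S. ennreal (normal_density (\<theta> i) 1 (x i))"
  let ?p = "\<lambda>w. \<Prod>i\<in>T. ennreal (normal_density 0 1 (w i))"
  let ?F = "\<lambda>y. ennreal (gauss_density n 1 \<theta> y) *
    (mix_ratio n lam 1 {..<n} y / mix_ratio n lam 1 S y)"
  have [measurable]: "(\<lambda>y. mix_ratio n lam 1 S y) \<in> borel_measurable (\<Pi>\<^sub>M i\<in>{..<n}. lborel)"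
    using assms(2) ST by (intro mix_ratio_measurable) auto
  have [measurable]: "(\<lambda>y. gauss_density n 1 \<theta> y) \<in> borel_measurable (\<Pi>\<^sub>M i\<in>{..<n}. lborel)"
    unfolding gauss_density_def by measurable
  have F: "?F \<in> borel_measurable (\<Pi>\<^sub>M i\<in>S \<union> T. lborel)"
    unfolding ST by measurable
  have mS: "mix_ratio n lam 1 S x / mix_ratio n lam 1 S x = 1" for x
    using mix_ratio_pos[OF assms(1) zero_less_one ST(3), of n x]
      mix_ratio_finite[OF assms(1) zero_less_one ST(3), of n x]
    by (intro ennreal_divide_self) auto
  have inner: "(\<integral>\<^sup>+w. ?F (merge S T (x, w)) \<partial>(\<Pi>\<^sub>M i\<in>T. lborel)) = ?q x" for x
  proof -
    have J: "mix_ratio n lam 1 S (merge S T (x, w)) = mix_ratio n lam 1 S x" for w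
      unfolding mix_ratio_def
      by (intro nn_integral_cong arg_cong2[where f = times] prod.cong refl) (auto simp: merge_def)
    have "ennreal (gauss_density n 1 \<theta> (merge S T (x, w))) = ?q x * ?p w" for w
    proof -
      have "ennreal (gauss_density n 1 \<theta> (merge S T (x, w)))
          = (\<Prod>i\<in>S \<union> T. ennreal (normal_density (\<theta> i) 1 (merge S T (x, w) i)))"
        by (simp add: gauss_density_def prod_ennreal ST)
      also have "\<dots> = ?q x * ?p w"
        using ST noise by (subst prod.union_disjoint)
          (auto intro!: arg_cong2[where f = times] prod.cong simp: merge_def T_def)
      finally show ?thesis .
    qed
    then have "(\<integral>\<^sup>+w. ?F (merge S T (x, w)) \<partial>(\<Pi>\<^sub>M i\<in>T. lborel))
        = (\<integral>\<^sup>+w. (?q x / mix_ratio n lam 1 S x) *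
            (?p w * mix_ratio n lam 1 (S \<union> T) (merge S T (x, w))) \<partial>(\<Pi>\<^sub>M i\<in>T. lborel))"
      by (intro nn_integral_cong) (simp add: J ST(1) divide_ennreal_def ac_simps)
    also have "\<dots> = ?q x / mix_ratio n lam 1 S x * mix_ratio n lam 1 S x"
    proof (subst nn_integral_cmult)
      have "(\<lambda>w. merge S T (x, w) i) \<in> borel_measurable (\<Pi>\<^sub>M i\<in>T. lborel)" if "i \<in> S \<union> T" for i
        using that by (cases "i \<in> S") (auto simp: merge_def)
      then have [measurable]: "(\<lambda>w. mix_ratio n lam 1 (S \<union> T) (merge S T (x, w)))
          \<in> borel_measurable (\<Pi>\<^sub>M i\<in>T. lborel)"
        using ST by (intro mix_ratio_measurable) auto
      show "(\<lambda>w. ?p w * mix_ratio n lam 1 (S \<union> T) (merge S T (x, w)))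
          \<in> borel_measurable (\<Pi>\<^sub>M i\<in>T. lborel)"
        by measurable
    qed (simp add: nn_integral_mix_ratio_noise[OF assms(1) ST(3,4,2)])
    also have "\<dots> = ?q x * (mix_ratio n lam 1 S x / mix_ratio n lam 1 S x)"
      by (simp add: divide_ennreal_def ac_simps)
    finally show ?thesis
      by (simp add: mS)
  qed
  have "(\<integral>\<^sup>+y. ?F y \<partial>lborel_n n) = (\<integral>\<^sup>+x. ?q x \<partial>(\<Pi>\<^sub>M i\<in>S. lborel))"
    using L.product_nn_integral_fold[OF ST(2-4) F] by (simp only: ST(1) inner)
  also have "\<dots> = 1"
    using ST by (subst L.product_nn_integral_prod) (auto simp: nn_integral_normal_density)
  finally show ?thesis .
qed

lemma nn_integral_gauss_density_coord:
  assumes "v > 0" "i < n" and [measurable]: "h \<in> borel_measurable borel"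
  shows "(\<integral>\<^sup>+y. ennreal (gauss_density n v \<theta> y) * h (y i) \<partial>lborel_n n)
    = (\<integral>\<^sup>+x. ennreal (normal_density (\<theta> i) (sqrt v) x) * h x \<partial>lborel)"
proof -
  interpret L: product_sigma_finite "\<lambda>_. lborel :: real measure" by standard
  let ?f = "\<lambda>j x. ennreal (normal_density (\<theta> j) (sqrt v) x) * (if j = i then h x else 1)"
  have "ennreal (gauss_density n v \<theta> y) * h (y i) = (\<Prod>j<n. ?f j (y j))" for y
    using assms(2) by (simp add: gauss_density_def prod_ennreal prod.distrib prod.delta)
  then have "(\<integral>\<^sup>+y. ennreal (gauss_density n v \<theta> y) * h (y i) \<partial>lborel_n n)
      = (\<Prod>j<n. \<integral>\<^sup>+x. ?f j x \<partial>lborel)"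
    by (simp only:) (rule L.product_nn_integral_prod, auto)
  also have "\<dots> = (\<Prod>j<n. if j = i then \<integral>\<^sup>+x. ?f i x \<partial>lborel else 1)"
    using assms(1) by (intro prod.cong refl) (auto simp: nn_integral_normal_density)
  also have "\<dots> = (\<integral>\<^sup>+x. ?f i x \<partial>lborel)"
    using assms(2) by (simp only: prod.delta finite_lessThan lessThan_iff if_True)
  finally show ?thesis
    by simp
qed

lemma nn_integral_gauss_density:
  assumes "v > 0"
  shows "(\<integral>\<^sup>+y. ennreal (gauss_density n v \<theta> y) \<partial>lborel_n n) = 1"
proof -
  interpret L: product_sigma_finite "\<lambda>_. lborel :: real measure" by standard
  show ?thesis
    unfolding gauss_density_def prod_ennreal [OF normal_density_nonneg, symmetric] using assms
    by (subst L.product_nn_integral_prod) (auto simp: nn_integral_normal_density)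
qed

lemma nn_integral_gauss_density_square:
  assumes "v > 0" "i < n" "K \<ge> 0"
  shows "(\<integral>\<^sup>+y. ennreal (gauss_density n v \<theta> y) * ennreal (K * (y i - \<theta> i)\<^sup>2) \<partial>lborel_n n)
    = ennreal (K * v)"
proof -
  have "has_bochner_integral lborel
      (\<lambda>x. normal_density (\<theta> i) (sqrt v) x * (x - \<theta> i)\<^sup>2) v"
    using normal_moment_even[of "sqrt v" "\<theta> i" 1] assms by simp
  then have "has_bochner_integral lborel
      (\<lambda>x. K * (normal_density (\<theta> i) (sqrt v) x * (x - \<theta> i)\<^sup>2)) (K * v)"
    by (rule has_bochner_integral_mult_right)
  note I = integrable.intros[OF this] and E = has_bochner_integral_integral_eq[OF this]
  have "(\<integral>\<^sup>+x. ennreal (K * (normal_density (\<theta> i) (sqrt v) x * (x - \<theta> i)\<^sup>2)) \<partial>lborel)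
      = ennreal (K * v)"
    unfolding E [symmetric] using assms by (intro nn_integral_eq_integral I) auto
  then show ?thesis
    using assms
    by (subst nn_integral_gauss_density_coord[where h = "\<lambda>x. ennreal (K * (x - \<theta> i)\<^sup>2)"])
      (auto simp: ennreal_mult [symmetric] mult.left_commute)
qed

section \<open>The cost of one signal coordinate\<close>

text \<open>
  The cost of a signal \<open>t\<close> beyond a constant.  A signal with \<open>t\<^sup>2 \<ge> 8 ln n\<close> is recognized at
  either precision.  The future observation alone carries the information \<open>t\<^sup>2 / r\<close>, which bounds the
  cost of a smaller signal; for \<open>r < 1\<close> this is replaced by \<open>ln n\<close>, the price of a
  slab whose prior weight is of order \<open>1 / n\<close>.
\<close>

definition coord_cost :: "nat \<Rightarrow> real \<Rightarrow> real \<Rightarrow> real" where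
  "coord_cost n r t =
     (if t\<^sup>2 \<ge> 8 * ln (real n) then 0 else if r < 1 then ln (real n) else 8 * ln (real n) / r)"

lemma coord_cost_nonneg: "n \<ge> 1 \<Longrightarrow> r > 0 \<Longrightarrow> 0 \<le> coord_cost n r t"
  by (simp add: coord_cost_def)

text \<open>
  The left-hand side is the log-likelihood ratio of the future observation against its slab
  prediction.  The quadratic terms in \<open>t\<close>, the terms linear in \<open>t\<close> and, by the exact factor
  \<open>exp (- lam \<bar>z\<bar> / \<tau>)\<close> in both slab bounds, the Laplace tails all cancel pointwise, so that only
  the errors of the two observations remain.
\<close>

lemma slab_ratio_log_bound:
  fixes y y' t r lam :: real
  assumes "lam > 0" "r > 0"
  shows "ln (slab_ratio lam 1 y) - ln (slab_ratio lam (1 + 1 / r) (y + y' / r)) + t * y' / r - t\<^sup>2 / (2 * r)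
    \<le> ln (lam * sqrt (2 * pi)) - ln (slab_const lam (1 + 1 / r)) + 3 / 2 * lam\<^sup>2
        + (y - t)\<^sup>2 + (y' - t)\<^sup>2 / 2"
proof -
  define \<tau> where "\<tau> = 1 + 1 / r"
  define z where "z = y + y' / r"
  define a where "a = y - t"
  define b where "b = y' - t"
  have \<tau>: "\<tau> > 1" "\<tau> > 0"
    using assms by (auto simp: \<tau>_def add_pos_pos)
  have yt: "y = t + a" "y' = t + b"
    by (simp_all add: a_def b_def)
  have z: "z = \<tau> * t + (a + b / r)"
    using assms by (simp add: z_def \<tau>_def yt field_simps)
  have "ln (slab_ratio lam 1 y) \<le> ln (lam * sqrt (2 * pi) * exp ((\<bar>y\<bar> - lam)\<^sup>2 / 2))"
    using slab_ratio_upper[OF assms(1), of y] slab_ratio_pos[OF assms(1), of 1 y] assms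
    by (subst ln_le_cancel_iff) auto
  also have "\<dots> = ln (lam * sqrt (2 * pi)) + (\<bar>y\<bar> - lam)\<^sup>2 / 2"
    using assms by (subst ln_mult) auto
  finally have up: "ln (slab_ratio lam 1 y) \<le> ln (lam * sqrt (2 * pi)) + y\<^sup>2 / 2 - lam * \<bar>y\<bar> + lam\<^sup>2 / 2"
    by (simp add: power2_eq_square algebra_simps add_divide_distrib diff_divide_distrib)
  have "ln (slab_const lam \<tau> * exp (z\<^sup>2 / (2 * \<tau>) - lam * \<bar>z\<bar> / \<tau>)) \<le> ln (slab_ratio lam \<tau> z)"
    using slab_ratio_lower[OF assms(1) \<tau>(2), of z] slab_const_pos[OF assms(1) \<tau>(2)]
      slab_ratio_pos[OF assms(1) \<tau>(2), of z]
    by (subst ln_le_cancel_iff) auto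
  then have lo: "ln (slab_const lam \<tau>) + z\<^sup>2 / (2 * \<tau>) - lam * (\<bar>z\<bar> / \<tau>) \<le> ln (slab_ratio lam \<tau> z)"
    using slab_const_pos[OF assms(1) \<tau>(2)] by (simp add: ln_mult)
  have "z\<^sup>2 / (2 * \<tau>) = \<tau> * t\<^sup>2 / 2 + t * (a + b / r) + (a + b / r)\<^sup>2 / (2 * \<tau>)"
  proof -
    have "(\<tau> * t + e)\<^sup>2 / (2 * \<tau>) = \<tau> * t\<^sup>2 / 2 + t * e + e\<^sup>2 / (2 * \<tau>)" for e
      using \<tau> by (simp add: power2_eq_square field_simps)
    then show ?thesis
      unfolding z .
  qed
  then have sq: "\<tau> * t\<^sup>2 / 2 + t * (a + b / r) \<le> z\<^sup>2 / (2 * \<tau>)"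
    using \<tau> by simp
  have "\<bar>z\<bar> / \<tau> = \<bar>y + (b - a) / (r + 1)\<bar>"
  proof -
    have "z / \<tau> = y + (b - a) / (r + 1)"
    proof -
      have "(r + 1) * z = \<tau> * (y * (r + 1) + (b - a))"
        using assms by (simp add: z_def \<tau>_def yt field_simps)
      moreover have "r + 1 \<noteq> 0" "\<tau> \<noteq> 0"
        using assms \<tau> by auto
      ultimately show ?thesis
        by (simp add: divide_eq_eq eq_divide_eq add_divide_eq_iff mult.commute)
    qed
    then show ?thesis
      using \<tau> by (metis abs_divide abs_of_pos)
  qed
  also have "\<dots> \<le> \<bar>y\<bar> + (\<bar>a\<bar> + \<bar>b\<bar>)"
  proof -
    have "\<bar>(b - a) / (r + 1)\<bar> \<le> \<bar>b - a\<bar>"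
      using assms by (simp add: abs_divide divide_le_eq mult_le_cancel_left1)
    then show ?thesis
      by linarith
  qed
  finally have "lam * (\<bar>z\<bar> / \<tau>) \<le> lam * (\<bar>y\<bar> + (\<bar>a\<bar> + \<bar>b\<bar>))"
    using assms by (intro mult_left_mono) auto
  moreover have "lam * \<bar>x\<bar> \<le> lam\<^sup>2 / 2 + x\<^sup>2 / 2" for x
    using zero_le_power2[of "\<bar>x\<bar> - lam"] by (simp add: power2_eq_square algebra_simps)
  from this[of a] this[of b]
  have "lam * (\<bar>y\<bar> + (\<bar>a\<bar> + \<bar>b\<bar>)) \<le> lam * \<bar>y\<bar> + lam\<^sup>2 + a\<^sup>2 / 2 + b\<^sup>2 / 2"
    by (simp add: algebra_simps)
  moreover have "y\<^sup>2 / 2 - (\<tau> * t\<^sup>2 / 2 + t * (a + b / r)) + t * y' / r - t\<^sup>2 / (2 * r) = a\<^sup>2 / 2"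
    unfolding \<tau>_def yt using assms by (simp add: power2_eq_square field_simps)
  ultimately show ?thesis
    using up lo sq unfolding \<tau>_def [symmetric] z_def [symmetric] a_def [symmetric] b_def [symmetric]
    by linarith
qed

text \<open>
  If the slab dominates for the lower precision, then dropping the spike for the higher one
  loses nothing, which settles large signals; that it dominates follows from the size of \<open>y\<close>,
  except for an error of the order \<open>(y - t)\<^sup>2\<close>.  For small signals and large \<open>r\<close> the quotient
  of two mixtures is at most the larger of the quotients of their components; here the
  spike's contribution \<open>t y' / r - t\<^sup>2 / (2 r)\<close> is small because \<open>t\<^sup>2 / r\<close> is.
\<close>

lemma coord_ratio_compare:
  assumes "lam > 0" "r > 0"
  obtains K where "K > 0"
    "\<And>n y y' t. n \<ge> 1 \<Longrightarrow> \<exists>R.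
      (\<forall>\<eta>. 1 / (4 * real n) \<le> \<eta> \<longrightarrow> \<eta> \<le> 1 / 2 \<longrightarrow>
        coord_ratio lam 1 \<eta> y \<le> exp R * coord_ratio lam (1 + 1 / r) \<eta> (y + y' / r)) \<and>
      R + t * y' / r - t\<^sup>2 / (2 * r) \<le> coord_cost n r t + K + K * (y - t)\<^sup>2 + K * (y' - t)\<^sup>2"
proof -
  define \<tau> where "\<tau> = 1 + 1 / r"
  have \<tau>: "\<tau> > 0"
    using assms by (simp add: \<tau>_def add_pos_pos)
  define K1 where "K1 = ln (lam * sqrt (2 * pi)) - ln (slab_const lam \<tau>) + 3 / 2 * lam\<^sup>2"
  define \<kappa> where "\<kappa> = ln (slab_const lam 1)"
  define K2 where "K2 = ln (1 + exp (lam\<^sup>2 / 2 - \<kappa>))"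
  define K where "K = 2 + \<bar>K1\<bar> + ln 4 + ln 5 + K2 + lam\<^sup>2 + \<bar>\<kappa>\<bar>"
  have K2: "K2 \<ge> 0"
    by (simp add: K2_def)
  have ln45: "ln (4::real) \<ge> 0" "ln (5::real) \<ge> 0"
    by auto
  have K: "K \<ge> 2"
    unfolding K_def using K2 ln45 by simp
  have "\<exists>R. (\<forall>\<eta>. 1 / (4 * real n) \<le> \<eta> \<longrightarrow> \<eta> \<le> 1 / 2 \<longrightarrow>
        coord_ratio lam 1 \<eta> y \<le> exp R * coord_ratio lam \<tau> \<eta> (y + y' / r)) \<and>
      R + t * y' / r - t\<^sup>2 / (2 * r) \<le> coord_cost n r t + K + K * (y - t)\<^sup>2 + K * (y' - t)\<^sup>2"
    if n: "n \<ge> 1" for n :: nat and y y' t :: real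
  proof -
    define g where "g = slab_ratio lam 1 y"
    define h where "h = slab_ratio lam \<tau> (y + y' / r)"
    have gh: "g > 0" "h > 0"
      using slab_ratio_pos assms \<tau> by (auto simp: g_def h_def)
    define L where "L = ln g - ln h + t * y' / r - t\<^sup>2 / (2 * r)"
    have L: "L \<le> K1 + (y - t)\<^sup>2 + (y' - t)\<^sup>2 / 2"
      using slab_ratio_log_bound[OF assms, of y y' t] by (simp add: L_def g_def h_def K1_def \<tau>_def)
    have g_lower: "\<kappa> + y\<^sup>2 / 2 - lam * \<bar>y\<bar> \<le> ln g"
      using slab_ratio_one_lower[OF assms(1)] by (simp add: \<kappa>_def g_def)
    have sqK: "c * (y - t)\<^sup>2 + d * (y' - t)\<^sup>2 \<le> K * (y - t)\<^sup>2 + K * (y' - t)\<^sup>2"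
      if "c \<le> 2" "d \<le> 2" for c d
      using that K by (intro add_mono mult_right_mono) auto
    show ?thesis
    proof (cases "t\<^sup>2 \<ge> 8 * ln (real n) \<or> r < 1")
      case True
      define R where "R = ln ((4 * real n + g) / h)"
      have compare: "coord_ratio lam 1 \<eta> y \<le> exp R * coord_ratio lam \<tau> \<eta> (y + y' / r)"
        if \<eta>: "1 / (4 * real n) \<le> \<eta>" "\<eta> \<le> 1 / 2" for \<eta>
      proof -
        have pos: "0 < \<eta>"
          using \<eta>(1) n by (intro less_le_trans[OF _ \<eta>(1)]) auto
        have "1 \<le> \<eta> * (4 * real n)"
          using \<eta>(1) n by (simp add: divide_le_eq)
        then have "coord_ratio lam 1 \<eta> y \<le> \<eta> * (4 * real n + g)"
          using pos by (simp add: coord_ratio_def g_def distrib_left)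
        also have "\<dots> = exp R * (\<eta> * h)"
          using gh n by (simp add: R_def)
        also have "\<dots> \<le> exp R * coord_ratio lam \<tau> \<eta> (y + y' / r)"
          using \<eta> by (intro mult_left_mono) (auto simp: coord_ratio_def h_def)
        finally show ?thesis .
      qed
      have R: "R + t * y' / r - t\<^sup>2 / (2 * r) = L + ln (1 + 4 * real n / g)"
      proof -
        have "ln (4 * real n + g) = ln (g * (1 + 4 * real n / g))"
          using gh by (simp add: distrib_left add.commute)
        also have "\<dots> = ln g + ln (1 + 4 * real n / g)"
          using gh by (intro ln_mult_pos) (auto intro: add_pos_nonneg)
        finally show ?thesis
          using gh n by (simp add: R_def L_def ln_div)
      qed
      have "L + ln (1 + 4 * real n / g) \<le> coord_cost n r t + K + K * (y - t)\<^sup>2 + K * (y' - t)\<^sup>2"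
      proof (cases "t\<^sup>2 \<ge> 8 * ln (real n)")
        case large: True
        \<comment> \<open>\<open>y\<^sup>2 / 2 - lam \<bar>y\<bar> \<ge> y\<^sup>2 / 4 - lam\<^sup>2\<close> and \<open>y\<^sup>2 \<ge> t\<^sup>2 / 2 - (y - t)\<^sup>2\<close>: both halvings together
          turn \<open>8 ln n\<close> into the \<open>ln n\<close> that the slab needs\<close>
        define X where "X = (y - t)\<^sup>2 / 4 + lam\<^sup>2 + \<bar>\<kappa>\<bar>"
        have "t\<^sup>2 \<le> 2 * y\<^sup>2 + 2 * (y - t)\<^sup>2"
          using zero_le_power2[of "2 * y - t"] by (simp add: power2_eq_square algebra_simps)
        moreover have "lam * \<bar>y\<bar> \<le> y\<^sup>2 / 4 + lam\<^sup>2"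
          using zero_le_power2[of "\<bar>y\<bar> / 2 - lam"] by (simp add: power2_eq_square algebra_simps)
        ultimately have "ln (real n) - X \<le> ln g"
          using g_lower large unfolding X_def by linarith
        then have "exp (ln (real n) - X) \<le> g"
          using gh by (metis exp_le_cancel_iff exp_ln)
        then have "real n \<le> g * exp X"
          using n by (simp add: exp_diff divide_le_eq)
        then have "real n / g \<le> exp X"
          using gh by (simp add: divide_le_eq mult.commute)
        moreover have "1 \<le> exp X"
          by (simp add: X_def)
        ultimately have "1 + 4 * (real n / g) \<le> 5 * exp X"
          by linarith
        then have "1 + 4 * real n / g \<le> 5 * exp X"
          by simp
        then have "ln (1 + 4 * real n / g) \<le> ln (5 * exp X)"
          using gh by (subst ln_le_cancel_iff) (auto intro: add_pos_nonneg)
        then have "ln (1 + 4 * real n / g) \<le> ln 5 + X"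
          by (simp add: ln_mult)
        then show ?thesis
          using L K2 ln45 sqK[of "5 / 4" "1 / 2"] coord_cost_nonneg[OF n assms(2), of t]
          unfolding K_def X_def by linarith
      next
        case small: False
        have "lam * \<bar>y\<bar> \<le> y\<^sup>2 / 2 + lam\<^sup>2 / 2"
          using zero_le_power2[of "\<bar>y\<bar> - lam"] by (simp add: power2_eq_square algebra_simps)
        then have "- ln g \<le> lam\<^sup>2 / 2 - \<kappa>"
          using g_lower by linarith
        then have "1 / g \<le> exp (lam\<^sup>2 / 2 - \<kappa>)"
          using gh by (metis exp_le_cancel_iff exp_ln exp_minus inverse_eq_divide)
        then have "4 * real n * (1 / g) \<le> 4 * real n * exp (lam\<^sup>2 / 2 - \<kappa>)"
          using n by (intro mult_left_mono) auto
        then have "1 + 4 * real n / g \<le> 4 * real n * (1 + exp (lam\<^sup>2 / 2 - \<kappa>))"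
          using n by (simp add: distrib_left)
        then have "ln (1 + 4 * real n / g) \<le> ln (4 * real n * (1 + exp (lam\<^sup>2 / 2 - \<kappa>)))"
          using gh n
          by (subst ln_le_cancel_iff) (auto intro!: add_pos_nonneg mult_pos_pos add_pos_pos)
        also have "\<dots> = ln 4 + ln (real n) + K2"
          using n add_pos_pos[OF zero_less_one exp_gt_zero[of "lam\<^sup>2 / 2 - \<kappa>"]]
          by (simp add: K2_def ln_mult)
        finally have "ln (1 + 4 * real n / g) \<le> ln 4 + ln (real n) + K2" .
        moreover have "ln 4 + K1 + K2 \<le> K"
          unfolding K_def using ln45 by (simp add: abs_ge_self add_increasing2)
        moreover have "coord_cost n r t = ln (real n)"
          using True small by (simp add: coord_cost_def)
        ultimately show ?thesis
          using L sqK[of 1 "1 / 2"] by simp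
      qed
      with R compare show ?thesis
        by (intro exI[of _ R]) auto
    next
      case False
      define R where "R = max 0 (ln g - ln h)"
      have compare: "coord_ratio lam 1 \<eta> y \<le> exp R * coord_ratio lam \<tau> \<eta> (y + y' / r)"
        if \<eta>: "1 / (4 * real n) \<le> \<eta>" "\<eta> \<le> 1 / 2" for \<eta>
      proof -
        have pos: "0 < \<eta>"
          using \<eta>(1) n by (intro less_le_trans[OF _ \<eta>(1)]) auto
        have "exp (ln g - ln h) \<le> exp R"
          by (simp add: R_def)
        then have "g \<le> exp R * h"
          using gh by (simp add: exp_diff divide_le_eq)
        then have "\<eta> * g \<le> exp R * (\<eta> * h)"
          using pos by (metis mult.left_commute mult_left_mono less_imp_le)
        moreover have "1 * (1 - \<eta>) \<le> exp R * (1 - \<eta>)"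
          using \<eta> by (intro mult_right_mono) (auto simp: R_def)
        ultimately show ?thesis
          by (simp add: coord_ratio_def g_def h_def distrib_left)
      qed
      have r: "r \<ge> 1" and t: "t\<^sup>2 < 8 * ln (real n)"
        using False by auto
      have "t * (y' - t) \<le> t\<^sup>2 / 2 + (y' - t)\<^sup>2 / 2"
      proof -
        have "t * x \<le> t\<^sup>2 / 2 + x\<^sup>2 / 2" for x
          using zero_le_power2[of "t - x"] by (simp add: power2_eq_square algebra_simps)
        then show ?thesis .
      qed
      then have "t * y' - t\<^sup>2 / 2 \<le> t\<^sup>2 + (y' - t)\<^sup>2 / 2"
        by (simp add: power2_eq_square right_diff_distrib)
      then have "(t * y' - t\<^sup>2 / 2) / r \<le> (t\<^sup>2 + (y' - t)\<^sup>2 / 2) / r"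
        using r by (intro divide_right_mono) auto
      then have "t * y' / r - t\<^sup>2 / (2 * r) \<le> t\<^sup>2 / r + (y' - t)\<^sup>2 / 2 / r"
        by (simp add: diff_divide_distrib add_divide_distrib)
      also have "\<dots> \<le> 8 * ln (real n) / r + (y' - t)\<^sup>2 / 2"
      proof (rule add_mono)
        show "t\<^sup>2 / r \<le> 8 * ln (real n) / r"
          using t r by (intro divide_right_mono) auto
        have "(y' - t)\<^sup>2 / 2 / r \<le> (y' - t)\<^sup>2 / 2 / 1"
          using r by (intro divide_left_mono) auto
        then show "(y' - t)\<^sup>2 / 2 / r \<le> (y' - t)\<^sup>2 / 2"
          by simp
      qed
      finally have spike: "t * y' / r - t\<^sup>2 / (2 * r) \<le> coord_cost n r t + (y' - t)\<^sup>2 / 2"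
        using r t by (simp add: coord_cost_def)
      have K1: "K1 \<le> K" "0 \<le> K"
        unfolding K_def using K2 ln45 by (auto intro: order_trans[OF abs_ge_self])
      have "R + t * y' / r - t\<^sup>2 / (2 * r) = max (t * y' / r - t\<^sup>2 / (2 * r)) L"
        unfolding R_def L_def by (auto simp: max_def)
      also have "\<dots> \<le> coord_cost n r t + K + K * (y - t)\<^sup>2 + K * (y' - t)\<^sup>2"
        using spike L K1 sqK[of 0 "1 / 2"] sqK[of 1 "1 / 2"] coord_cost_nonneg[OF n assms(2), of t]
        by (intro max.boundedI) linarith+
      finally show ?thesis
        using compare by (intro exI[of _ R]) auto
    qed
  qed
  then show thesis
    using K by (intro that[of K]) (auto simp: \<tau>_def)
qed

section \<open>The risk bound\<close>

text \<open>For an upper bound the negative part of the integrand may be dropped.\<close>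

lemma ext_integral_le:
  assumes "\<And>x. f x \<le> enn2ereal (g x)"
  shows "ext_integral M f \<le> enn2ereal (\<integral>\<^sup>+x. g x \<partial>M)"
proof -
  have "ext_integral M f \<le> enn2ereal (\<integral>\<^sup>+x. e2ennreal (f x) \<partial>M) - 0"
    unfolding ext_integral_def by (intro ereal_minus_mono) auto
  also have "\<dots> \<le> enn2ereal (\<integral>\<^sup>+x. g x \<partial>M)"
  proof -
    have "e2ennreal (f x) \<le> g x" for x
      using e2ennreal_mono[OF assms[of x]] by simp
    then show ?thesis
      by (simp add: less_eq_ennreal.rep_eq [symmetric] nn_integral_mono)
  qed
  finally show ?thesis .
qed

lemma ereal_times_le_enn2ereal:
  assumes "0 \<le> a" "x \<le> enn2ereal b"
  shows "ereal a * x \<le> enn2ereal (ennreal a * b)"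
  using ereal_mult_left_mono[OF assms(2), of "ereal a"] assms(1)
  by (simp add: times_ennreal.rep_eq)

text \<open>
  With \<open>N\<close> and \<open>J\<close> the mixture ratios of the data over all coordinates and over the support,
  \<open>ln N \<le> ln J + N / J - 1\<close>, and \<open>J\<close> is compared with the mixture ratio of the combined
  observation.  All terms on the right are integrable functions of single coordinates, except
  \<open>N / J\<close>, whose mean is one.
\<close>

lemma log_predictive_ratio_le:
  fixes n :: nat and R \<theta> y y' :: "nat \<Rightarrow> real"
  defines "S \<equiv> {i. i < n \<and> \<theta> i \<noteq> 0}"
  assumes "lam > 0" "r > 0" "n \<ge> 1"
    and R: "\<And>i \<eta>. i \<in> S \<Longrightarrow> 1 / (4 * real n) \<le> \<eta> \<Longrightarrow> \<eta> \<le> 1 / 2 \<Longrightarrow>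
      coord_ratio lam 1 \<eta> (y i) \<le> exp (R i) * coord_ratio lam (1 + 1 / r) \<eta> (y i + y' i / r)"
  shows "ln (gauss_density n r \<theta> y' /
      predictive_density n r (spike_slab_prior n 2 (real n + 1) lam) y y')
    \<le> ln 64 + real (card S) * ln 8 - 1 + (\<Sum>i\<in>S. R i + \<theta> i * y' i / r - (\<theta> i)\<^sup>2 / (2 * r)) +
      enn2real (mix_ratio n lam 1 {..<n} y / mix_ratio n lam 1 S y)"
proof -
  let ?\<tau> = "1 + 1 / r" and ?z = "\<lambda>i. y i + y' i / r"
  have \<tau>: "?\<tau> > 0"
    using assms(3) by (simp add: add_pos_pos)
  have S: "S \<subseteq> {..<n}" "finite S"
    by (auto simp: S_def)
  define N where "N = enn2real (mix_ratio n lam 1 {..<n} y)"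
  define J where "J = enn2real (mix_ratio n lam 1 S y)"
  define N' where "N' = enn2real (mix_ratio n lam ?\<tau> {..<n} ?z)"
  have pos: "N > 0" "J > 0" "N' > 0"
    unfolding N_def J_def N'_def enn2real_positive_iff
    using mix_ratio_pos mix_ratio_finite assms(2) \<tau> S(2) by (simp_all add: less_top)
  have en: "mix_ratio n lam 1 {..<n} y = ennreal N" "mix_ratio n lam 1 S y = ennreal J"
      "mix_ratio n lam ?\<tau> {..<n} ?z = ennreal N'"
    unfolding N_def J_def N'_def
    using mix_ratio_finite assms(2) \<tau> S(2) by (simp_all add: less_top)
  have "gauss_density n r \<theta> y' / predictive_density n r (spike_slab_prior n 2 (real n + 1) lam) y y'
      = (\<Prod>i<n. gauss_tilt (1 / r) (y' i / r) (\<theta> i)) * (N / N')"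
    using gauss_density_pos[OF assms(3), of n "\<lambda>_. 0" y']
    unfolding predictive_density_eq[OF assms(2,3)] gauss_density_eq_tilt[OF assms(3), of n \<theta> y']
      N_def [symmetric] N'_def [symmetric] by simp
  also have "ln \<dots> = ln (\<Prod>i<n. gauss_tilt (1 / r) (y' i / r) (\<theta> i)) + (ln N - ln N')"
    using pos by (subst ln_mult_pos) (auto simp: ln_div intro!: prod_pos)
  also have "ln (\<Prod>i<n. gauss_tilt (1 / r) (y' i / r) (\<theta> i)) = (\<Sum>i<n. \<theta> i * y' i / r - (\<theta> i)\<^sup>2 / (2 * r))"
    by (subst ln_prod) (auto simp: gauss_tilt_def mult.commute)
  also have "\<dots> = (\<Sum>i\<in>S. \<theta> i * y' i / r - (\<theta> i)\<^sup>2 / (2 * r))"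
    by (intro sum.mono_neutral_right) (auto simp: S_def)
  finally have lhs: "ln (gauss_density n r \<theta> y' /
      predictive_density n r (spike_slab_prior n 2 (real n + 1) lam) y y')
    = (\<Sum>i\<in>S. \<theta> i * y' i / r - (\<theta> i)\<^sup>2 / (2 * r)) + (ln N - ln N')" .
  have "ennreal J \<le> ennreal (64 * 8 ^ card S * exp (\<Sum>i\<in>S. R i)) * ennreal N'"
    unfolding en [symmetric] by (rule mix_ratio_compare[OF assms(2) \<tau> S(1) assms(4) R])
  then have "J \<le> 64 * 8 ^ card S * exp (\<Sum>i\<in>S. R i) * N'"
    using pos by (simp add: ennreal_mult' [symmetric])
  then have "ln J \<le> ln (64 * 8 ^ card S * exp (\<Sum>i\<in>S. R i) * N')"
    using pos by (subst ln_le_cancel_iff) auto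
  also have "\<dots> = ln 64 + real (card S) * ln 8 + (\<Sum>i\<in>S. R i) + ln N'"
    using pos by (simp add: ln_mult_pos ln_realpow)
  finally have J: "ln J - ln N' \<le> ln 64 + real (card S) * ln 8 + (\<Sum>i\<in>S. R i)"
    by simp
  have "ln N - ln J \<le> N / J - 1"
    using ln_le_minus_one[of "N / J"] pos by (simp add: ln_div)
  moreover have "enn2real (mix_ratio n lam 1 {..<n} y / mix_ratio n lam 1 S y) = N / J"
    unfolding en using pos by (simp add: divide_ennreal)
  moreover have "(\<Sum>i\<in>S. R i + \<theta> i * y' i / r - (\<theta> i)\<^sup>2 / (2 * r))
      = (\<Sum>i\<in>S. R i) + (\<Sum>i\<in>S. \<theta> i * y' i / r - (\<theta> i)\<^sup>2 / (2 * r))"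
    by (simp add: sum.distrib [symmetric] add_diff_eq)
  ultimately show ?thesis
    unfolding lhs using J by linarith
qed

text \<open>
  Every term of the pointwise bound is nonnegative, so the nested integrals are evaluated as
  nonnegative integrals: the squared errors have means \<open>1\<close> and \<open>r\<close>, and \<open>N / J\<close> has mean one.
  The constant may depend on \<open>lam\<close> and \<open>r\<close>, but is uniform in \<open>n\<close> and \<open>\<theta>\<close>.
\<close>

lemma risk_le:
  assumes "lam > 0" "r > 0"
  obtains K where "K > 0"
    "\<And>n \<theta>. n \<ge> 1 \<Longrightarrow> risk n r \<theta> (predictive_density n r (spike_slab_prior n 2 (real n + 1) lam))
      \<le> ereal (K + K * real (l0_norm n \<theta>) + (\<Sum>i | i < n \<and> \<theta> i \<noteq> 0. coord_cost n r (\<theta> i)))"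
proof -
  obtain K where K: "K > 0" and R_ex: "\<And>n y y' t. n \<ge> 1 \<Longrightarrow> \<exists>R.
      (\<forall>\<eta>. 1 / (4 * real n) \<le> \<eta> \<longrightarrow> \<eta> \<le> 1 / 2 \<longrightarrow>
        coord_ratio lam 1 \<eta> y \<le> exp R * coord_ratio lam (1 + 1 / r) \<eta> (y + y' / r)) \<and>
      R + t * y' / r - t\<^sup>2 / (2 * r) \<le> coord_cost n r t + K + K * (y - t)\<^sup>2 + K * (y' - t)\<^sup>2"
    by (rule coord_ratio_compare[OF assms]) (rule that)
  define K' where "K' = ln 64 + ln 8 + K + K + K * r"
  have ln: "ln (64::real) = 6 * ln 2" "ln (8::real) = 3 * ln 2" "ln (2::real) \<ge> 1 / 2"
    using ln_realpow[of 2 6] ln_realpow[of 2 3] ln2_ge_two_thirds by auto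
  have "risk n r \<theta> (predictive_density n r (spike_slab_prior n 2 (real n + 1) lam))
      \<le> ereal (K' + K' * real (l0_norm n \<theta>) + (\<Sum>i | i < n \<and> \<theta> i \<noteq> 0. coord_cost n r (\<theta> i)))"
    if n: "n \<ge> 1" for n \<theta>
  proof -
    let ?p = "predictive_density n r (spike_slab_prior n 2 (real n + 1) lam)"
    define S where "S = {i. i < n \<and> \<theta> i \<noteq> 0}"
    have S: "S \<subseteq> {..<n}" "finite S" "\<And>i. i \<in> S \<Longrightarrow> i < n"
      by (auto simp: S_def)
    define c where "c = ln 64 + real (card S) * ln 8 - 1 + (\<Sum>i\<in>S. coord_cost n r (\<theta> i) + K)"
    \<comment> \<open>the \<open>- 1\<close> of \<open>N / J - 1\<close> is covered by \<open>ln 64\<close>, so that the whole bound is nonnegative\<close>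
    have c: "c \<ge> 0"
    proof -
      have "0 \<le> (\<Sum>i\<in>S. coord_cost n r (\<theta> i) + K)"
        using coord_cost_nonneg[OF n assms(2)] K by (intro sum_nonneg add_nonneg_nonneg) auto
      moreover have "0 \<le> real (card S) * ln 8"
        by simp
      ultimately show ?thesis
        using ln unfolding c_def by linarith
    qed
    define q where "q y = mix_ratio n lam 1 {..<n} y / mix_ratio n lam 1 S y" for y
    have [measurable]: "(\<lambda>y. mix_ratio n lam 1 S y) \<in> borel_measurable (\<Pi>\<^sub>M i\<in>{..<n}. lborel)"
      using S by (intro mix_ratio_measurable) auto
    have [measurable]: "q \<in> borel_measurable (\<Pi>\<^sub>M i\<in>{..<n}. lborel)"
      unfolding q_def by measurable
    have q_fin: "q y = ennreal (enn2real (q y))" for y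
    proof -
      have "q y < \<infinity>"
        unfolding q_def
        using mix_ratio_pos[OF assms(1) zero_less_one S(2), of n y]
          mix_ratio_finite[OF assms(1) zero_less_one finite_lessThan, of n n y]
        by (auto simp: less_top [symmetric] ennreal_divide_eq_top_iff)
      then show ?thesis
        by simp
    qed
    have [measurable]: "(\<lambda>y. gauss_density n v \<theta> y) \<in> borel_measurable (\<Pi>\<^sub>M i\<in>{..<n}. lborel)" for v
      unfolding gauss_density_def by measurable
    define sq where "sq y = (\<Sum>i\<in>S. ennreal (K * (y i - \<theta> i)\<^sup>2))" for y
    have sq_i: "(\<lambda>y. ennreal (K * (y i - \<theta> i)\<^sup>2)) \<in> borel_measurable (\<Pi>\<^sub>M i\<in>{..<n}. lborel)"
      if "i \<in> S" for i
    proof -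
      have [measurable]: "i \<in> {..<n}"
        using that S by auto
      show ?thesis by measurable
    qed
    then have [measurable]: "sq \<in> borel_measurable (\<Pi>\<^sub>M i\<in>{..<n}. lborel)"
      unfolding sq_def by (rule borel_measurable_sum)
    have int_sq: "(\<integral>\<^sup>+y. ennreal (gauss_density n v \<theta> y) * sq y \<partial>lborel_n n) = ennreal (real (card S) * (K * v))"
      if "v > 0" for v
    proof -
      have "(\<integral>\<^sup>+y. ennreal (gauss_density n v \<theta> y) * sq y \<partial>lborel_n n)
          = (\<Sum>i\<in>S. \<integral>\<^sup>+y. ennreal (gauss_density n v \<theta> y) * ennreal (K * (y i - \<theta> i)\<^sup>2) \<partial>lborel_n n)"
        unfolding sq_def sum_distrib_left
        by (intro nn_integral_sum borel_measurable_times_ennreal sq_i) measurable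
      also have "\<dots> = (\<Sum>i\<in>S. ennreal (K * v))"
        using K that S by (intro sum.cong refl nn_integral_gauss_density_square) auto
      also have "\<dots> = ennreal (real (card S) * (K * v))"
        using K that by (simp add: ennreal_mult' ennreal_of_nat_eq_real_of_nat)
      finally show ?thesis .
    qed
    have pw: "ereal (ln (gauss_density n r \<theta> y' / ?p y y')) \<le> enn2ereal (ennreal c + sq y + q y + sq y')"
      for y y'
    proof -
      obtain R where R: "\<And>i \<eta>. 1 / (4 * real n) \<le> \<eta> \<Longrightarrow> \<eta> \<le> 1 / 2 \<Longrightarrow>
          coord_ratio lam 1 \<eta> (y i) \<le> exp (R i) * coord_ratio lam (1 + 1 / r) \<eta> (y i + y' i / r)"
        "\<And>i. R i + \<theta> i * y' i / r - (\<theta> i)\<^sup>2 / (2 * r)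
          \<le> coord_cost n r (\<theta> i) + K + K * (y i - \<theta> i)\<^sup>2 + K * (y' i - \<theta> i)\<^sup>2"
      proof -
        have "\<forall>i. \<exists>R. (\<forall>\<eta>. 1 / (4 * real n) \<le> \<eta> \<longrightarrow> \<eta> \<le> 1 / 2 \<longrightarrow>
            coord_ratio lam 1 \<eta> (y i) \<le> exp R * coord_ratio lam (1 + 1 / r) \<eta> (y i + y' i / r)) \<and>
          R + \<theta> i * y' i / r - (\<theta> i)\<^sup>2 / (2 * r)
            \<le> coord_cost n r (\<theta> i) + K + K * (y i - \<theta> i)\<^sup>2 + K * (y' i - \<theta> i)\<^sup>2"
          using R_ex[OF n] by blast
        from choice[OF this] show thesis
          using that by blast
      qed
      have "ln (gauss_density n r \<theta> y' / ?p y y')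
          \<le> ln 64 + real (card S) * ln 8 - 1 + (\<Sum>i\<in>S. R i + \<theta> i * y' i / r - (\<theta> i)\<^sup>2 / (2 * r)) + enn2real (q y)"
        unfolding S_def q_def by (rule log_predictive_ratio_le[OF assms n R(1)])
      also have "\<dots> \<le> ln 64 + real (card S) * ln 8 - 1 + (\<Sum>i\<in>S. coord_cost n r (\<theta> i) + K +
          K * (y i - \<theta> i)\<^sup>2 + K * (y' i - \<theta> i)\<^sup>2) + enn2real (q y)"
        using R(2) by (intro add_mono order_refl sum_mono)
      also have "\<dots> = c + (\<Sum>i\<in>S. K * (y i - \<theta> i)\<^sup>2) + enn2real (q y) + (\<Sum>i\<in>S. K * (y' i - \<theta> i)\<^sup>2)"
        unfolding c_def by (simp add: sum.distrib)
      finally have le: "ln (gauss_density n r \<theta> y' / ?p y y') \<le> \<dots>" .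
      have sq: "sq x = ennreal (\<Sum>i\<in>S. K * (x i - \<theta> i)\<^sup>2)" "0 \<le> (\<Sum>i\<in>S. K * (x i - \<theta> i)\<^sup>2)" for x
        using K by (auto simp: sq_def sum_ennreal intro!: sum_nonneg)
      let ?X = "c + (\<Sum>i\<in>S. K * (y i - \<theta> i)\<^sup>2) + enn2real (q y) + (\<Sum>i\<in>S. K * (y' i - \<theta> i)\<^sup>2)"
      have "ennreal ?X = ennreal c + sq y + ennreal (enn2real (q y)) + sq y'"
        unfolding sq(1) using c sq(2) by (simp add: ennreal_plus)
      then have X: "ennreal ?X = ennreal c + sq y + q y + sq y'"
        by (simp only: q_fin [symmetric])
      have "ereal (ln (gauss_density n r \<theta> y' / ?p y y')) \<le> ereal ?X"
        using le by simp
      also have "\<dots> = enn2ereal (ennreal ?X)"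
        using c sq(2) by (intro enn2ereal_ennreal [symmetric] add_nonneg_nonneg) auto
      finally show ?thesis
        unfolding X .
    qed
    have inner: "ext_integral (lborel_n n) (\<lambda>y'. ereal (gauss_density n r \<theta> y' *
        ln (gauss_density n r \<theta> y' / ?p y y')))
      \<le> enn2ereal (ennreal (c + real (card S) * (K * r)) + sq y + q y)" for y
    proof -
      have "ext_integral (lborel_n n) (\<lambda>y'. ereal (gauss_density n r \<theta> y' *
          ln (gauss_density n r \<theta> y' / ?p y y')))
        \<le> enn2ereal (\<integral>\<^sup>+y'. ennreal (gauss_density n r \<theta> y') * (ennreal c + sq y + q y + sq y') \<partial>lborel_n n)"
        using ereal_times_le_enn2ereal[OF less_imp_le[OF gauss_density_pos[OF assms(2)]] pw]
        by (intro ext_integral_le) simp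
      also have "(\<integral>\<^sup>+y'. ennreal (gauss_density n r \<theta> y') * (ennreal c + sq y + q y + sq y') \<partial>lborel_n n)
          = (\<integral>\<^sup>+y'. (ennreal c + sq y + q y) * ennreal (gauss_density n r \<theta> y') +
              ennreal (gauss_density n r \<theta> y') * sq y' \<partial>lborel_n n)"
        by (intro nn_integral_cong) (simp only: distrib_left mult.commute)
      also have "\<dots> = (ennreal c + sq y + q y) + ennreal (real (card S) * (K * r))"
        using assms(2)
        by (simp add: nn_integral_add nn_integral_cmult nn_integral_gauss_density int_sq)
      also have "\<dots> = ennreal (c + real (card S) * (K * r)) + sq y + q y"
        using c K assms(2) by (simp add: ac_simps)
      finally show ?thesis .
    qed
    have "risk n r \<theta> ?p \<le> enn2ereal (\<integral>\<^sup>+y. ennreal (gauss_density n 1 \<theta> y) *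
        (ennreal (c + real (card S) * (K * r)) + sq y + q y) \<partial>lborel_n n)"
      unfolding risk_def
      by (intro ext_integral_le ereal_times_le_enn2ereal inner less_imp_le[OF gauss_density_pos]) simp
    also have "(\<integral>\<^sup>+y. ennreal (gauss_density n 1 \<theta> y) *
        (ennreal (c + real (card S) * (K * r)) + sq y + q y) \<partial>lborel_n n)
      = (\<integral>\<^sup>+y. (ennreal (c + real (card S) * (K * r)) * ennreal (gauss_density n 1 \<theta> y) +
          ennreal (gauss_density n 1 \<theta> y) * sq y) + ennreal (gauss_density n 1 \<theta> y) * q y \<partial>lborel_n n)"
      by (intro nn_integral_cong) (simp only: distrib_left mult.commute)
    also have "\<dots> = ennreal (c + real (card S) * (K * r)) + ennreal (real (card S) * (K * 1)) + 1"
    proof -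
      have "(\<integral>\<^sup>+y. ennreal (gauss_density n 1 \<theta> y) * q y \<partial>lborel_n n) = 1"
        unfolding q_def by (rule nn_integral_mix_ratio_quotient[OF assms(1) S(1)]) (simp add: S_def)
      then show ?thesis
        using int_sq[OF zero_less_one]
        by (simp add: nn_integral_add nn_integral_cmult nn_integral_gauss_density)
    qed
    also have "\<dots> = ennreal (c + real (card S) * (K * r) + real (card S) * K + 1)"
      using c K assms(2) by (simp add: ennreal_plus [symmetric] ennreal_1 [symmetric] del: ennreal_plus ennreal_1)
    also have "enn2ereal \<dots> = ereal (c + real (card S) * (K * r) + real (card S) * K + 1)"
      using c K assms(2) by (intro enn2ereal_ennreal) auto
    also have "\<dots> \<le> ereal (K' + K' * real (l0_norm n \<theta>) + (\<Sum>i\<in>S. coord_cost n r (\<theta> i)))"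
    proof -
      have "c = ln 64 + real (card S) * ln 8 - 1 + (\<Sum>i\<in>S. coord_cost n r (\<theta> i)) + real (card S) * K"
        by (simp add: c_def sum.distrib)
      moreover have "0 \<le> real (card S) * ln 64" "0 \<le> K * r" "0 \<le> ln (8::real)"
        using K assms(2) by auto
      moreover have "l0_norm n \<theta> = card S"
        by (simp add: l0_norm_def S_def)
      ultimately show ?thesis
        using K by (simp add: K'_def algebra_simps)
    qed
    finally show ?thesis
      by (simp add: S_def)
  qed
  moreover have "K' > 0"
  proof -
    have "K * r > 0"
      using K assms(2) by simp
    then show ?thesis
      using K ln unfolding K'_def by linarith
  qed
  ultimately show thesis
    by (intro that[of K']) auto
qed

lemma sparse_vectors_l0: "\<theta> \<in> sparse_vectors n s \<Longrightarrow> l0_norm n \<theta> \<le> s"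
  by (simp add: sparse_vectors_def)

theorem theorem5:
  shows "\<exists>C>0. \<forall>(r::real) (lam::real) (M::real) (s::nat \<Rightarrow> nat).
    r > 0 \<longrightarrow> slab_rate r lam \<longrightarrow> M > 0 \<longrightarrow> (M\<^sup>2 - 2) / 4 > 2 \<longrightarrow>
    (\<forall>n\<ge>1. 1 \<le> s n \<and> s n \<le> n) \<longrightarrow> (\<lambda>n. real (s n) / real n) \<longlonglongrightarrow> 0 \<longrightarrow>
    (\<forall>\<^sub>F n in sequentially.
       (SUP \<theta>\<in>sparse_vectors_min n (s n) M.
          risk n r \<theta> (predictive_density n r (spike_slab_prior n 2 (real n + 1) lam)))
       \<le> ereal (C * (real (s n) / (r + 1) * ln (real n / real (s n))))) \<and>
    (\<forall>\<^sub>F n in sequentially.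
       (SUP \<theta>\<in>sparse_vectors n (s n).
          risk n r \<theta> (predictive_density n r (spike_slab_prior n 2 (real n + 1) lam)))
       \<le> ereal (C * (real (s n) / (r + 1) * ln (real n))))"
  \<comment> \<open>\<open>coord_cost\<close> contributes 16 and the lower order terms at most 1\<close>
proof (intro exI[of _ "17::real"] conjI allI impI)
  fix r lam M :: real and s :: "nat \<Rightarrow> nat"
  assume r: "r > 0" and rate: "slab_rate r lam" and M: "M > 0" "(M\<^sup>2 - 2) / 4 > 2"
    and s: "\<forall>n\<ge>1. 1 \<le> s n \<and> s n \<le> n" and s0: "(\<lambda>n. real (s n) / real n) \<longlonglongrightarrow> 0"
  let ?risk = "\<lambda>n \<theta>. risk n r \<theta> (predictive_density n r (spike_slab_prior n 2 (real n + 1) lam))"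
  have lam: "lam > 0"
    using rate by (simp add: slab_rate_def Let_def)
  obtain K where K: "K > 0" and risk: "\<And>n \<theta>. n \<ge> 1 \<Longrightarrow> ?risk n \<theta>
      \<le> ereal (K + K * real (l0_norm n \<theta>) + (\<Sum>i | i < n \<and> \<theta> i \<noteq> 0. coord_cost n r (\<theta> i)))"
    by (rule risk_le[OF lam r]) (rule that)
  have const: "K + K * real (l0_norm n \<theta>) \<le> real (s n) * (2 * K)"
    if "n \<ge> 1" "\<theta> \<in> sparse_vectors n (s n)" for n \<theta>
  proof -
    have "K * 1 \<le> K * real (s n)" "K * real (l0_norm n \<theta>) \<le> K * real (s n)"
      using K s that sparse_vectors_l0[OF that(2)] by (auto intro!: mult_left_mono)
    then have "K + K * real (l0_norm n \<theta>) \<le> 2 * (K * real (s n))"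
      by linarith
    then show ?thesis
      by (simp only: mult_ac)
  qed
  show "\<forall>\<^sub>F n in sequentially. (SUP \<theta>\<in>sparse_vectors_min n (s n) M. ?risk n \<theta>)
      \<le> ereal (17 * (real (s n) / (r + 1) * ln (real n / real (s n))))"
  proof -
    \<comment> \<open>\<open>s n / n < e\<close> says that the logarithmic factor exceeds the bounded cost \<open>2 K\<close> per coordinate\<close>
    define e where "e = exp (- (2 * K * (r + 1)))"
    have "\<forall>\<^sub>F n in sequentially. real (s n) / real n < e"
      using s0 by (rule order_tendstoD) (simp add: e_def)
    then show ?thesis
      using eventually_ge_at_top[of 1]
    proof (eventually_elim, intro SUP_least)
      fix n \<theta>
      assume sn: "real (s n) / real n < e" and n: "1 \<le> n" and \<theta>: "\<theta> \<in> sparse_vectors_min n (s n) M"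
      have s1: "s n \<ge> 1"
        using s n by simp
      have "2 * K * (r + 1) \<le> ln (real n / real (s n))"
      proof -
        have "ln (real (s n) / real n) \<le> ln e"
          using sn s1 n by (subst ln_le_cancel_iff) (auto simp: e_def)
        then show ?thesis
          using s1 n by (simp add: e_def ln_div)
      qed
      then have "2 * K \<le> ln (real n / real (s n)) / (r + 1)"
        using r by (simp add: le_divide_eq)
      moreover from this have "0 \<le> ln (real n / real (s n)) / (r + 1)"
        using K by linarith
      ultimately have L: "2 * K \<le> 17 * (ln (real n / real (s n)) / (r + 1))"
        by linarith
      have "coord_cost n r (\<theta> i) = 0" if i: "i < n" "\<theta> i \<noteq> 0" for i
      proof -
        have ln0: "0 \<le> ln (real n)"
          using n by simp
        have "M * sqrt (ln (real n)) \<le> \<bar>\<theta> i\<bar>"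
          using \<theta> i by (auto simp: sparse_vectors_min_def less_imp_le)
        then have "(M * sqrt (ln (real n)))\<^sup>2 \<le> \<bar>\<theta> i\<bar>\<^sup>2"
          using M(1) ln0 by (intro power_mono) auto
        then have "M\<^sup>2 * ln (real n) \<le> (\<theta> i)\<^sup>2"
          using ln0 by (simp add: power_mult_distrib)
        moreover have "8 * ln (real n) \<le> M\<^sup>2 * ln (real n)"
          using M(2) ln0 by (intro mult_right_mono) auto
        ultimately show ?thesis
          by (simp add: coord_cost_def)
      qed
      then have "(\<Sum>i | i < n \<and> \<theta> i \<noteq> 0. coord_cost n r (\<theta> i)) = 0"
        by (intro sum.neutral) auto
      then have "?risk n \<theta> \<le> ereal (K + K * real (l0_norm n \<theta>))"
        using risk[OF n, of \<theta>] by simp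
      also have "\<dots> \<le> ereal (real (s n) * (2 * K))"
        using const[OF n] \<theta> by (simp add: sparse_vectors_min_def)
      also have "\<dots> \<le> ereal (real (s n) * (17 * (ln (real n / real (s n)) / (r + 1))))"
        using mult_left_mono[OF L, of "real (s n)"] by (simp only: ereal_less_eq of_nat_0_le_iff)
      finally show "?risk n \<theta> \<le> ereal (17 * (real (s n) / (r + 1) * ln (real n / real (s n))))"
        by (simp add: mult_ac)
    qed
  qed
  show "\<forall>\<^sub>F n in sequentially. (SUP \<theta>\<in>sparse_vectors n (s n). ?risk n \<theta>)
      \<le> ereal (17 * (real (s n) / (r + 1) * ln (real n)))"
  proof -
    have "filterlim (\<lambda>n. ln (real n)) at_top sequentially"
      using filterlim_compose[OF ln_at_top filterlim_real_sequentially] .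
    then have "\<forall>\<^sub>F n in sequentially. 2 * K * (r + 1) \<le> ln (real n)"
      by (simp add: filterlim_at_top)
    then show ?thesis
      using eventually_ge_at_top[of 1]
    proof (eventually_elim, intro SUP_least)
      fix n \<theta>
      assume ln: "2 * K * (r + 1) \<le> ln (real n)" and n: "1 \<le> n" and \<theta>: "\<theta> \<in> sparse_vectors n (s n)"
      define L where "L = ln (real n) / (r + 1)"
      have L: "2 * K \<le> L"
        using ln r by (simp add: L_def le_divide_eq)
      have ln0: "0 \<le> ln (real n)"
        using n by simp
      have "coord_cost n r t \<le> 16 * L" for t
      proof (cases "r < 1")
        case True
        then have "ln (real n) * (r + 1) \<le> ln (real n) * 16"
          using ln0 by (intro mult_left_mono) auto
        then have "ln (real n) \<le> 16 * L"
          using r by (simp add: L_def le_divide_eq mult.commute)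
        then show ?thesis
          using True ln0 r by (simp add: coord_cost_def L_def)
      next
        case False
        then have "8 * ln (real n) * (r + 1) \<le> 16 * ln (real n) * r"
          using mult_left_mono[of 1 r "8 * ln (real n)"] ln0 by (simp add: algebra_simps)
        then have "8 * ln (real n) / r \<le> 16 * L"
          using r by (simp add: L_def divide_simps mult_ac)
        then show ?thesis
          using False ln0 r by (simp add: coord_cost_def L_def)
      qed
      then have "(\<Sum>i | i < n \<and> \<theta> i \<noteq> 0. coord_cost n r (\<theta> i)) \<le> real (l0_norm n \<theta>) * (16 * L)"
        unfolding l0_norm_def by (intro sum_bounded_above)
      also have "\<dots> \<le> real (s n) * (16 * L)"
        using sparse_vectors_l0[OF \<theta>] L K by (intro mult_right_mono) auto
      finally have cost: "(\<Sum>i | i < n \<and> \<theta> i \<noteq> 0. coord_cost n r (\<theta> i)) \<le> real (s n) * (16 * L)" .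
      have "real (s n) * (2 * K) \<le> real (s n) * L"
        using L by (intro mult_left_mono) auto
      then have "K + K * real (l0_norm n \<theta>) + (\<Sum>i | i < n \<and> \<theta> i \<noteq> 0. coord_cost n r (\<theta> i))
          \<le> 17 * (real (s n) * L)"
        using const[OF n \<theta>] cost by linarith
      then have "?risk n \<theta> \<le> ereal (17 * (real (s n) * L))"
        using risk[OF n, of \<theta>] by (meson ereal_less_eq(3) order_trans)
      then show "?risk n \<theta> \<le> ereal (17 * (real (s n) / (r + 1) * ln (real n)))"
        by (simp add: L_def)
    qed
  qed
qed simp

end
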